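(* Let $p\ge 2$ and suppose $z(t)\in L^p(\Omega,\mathbb P)$ for every $t\in[0,T]$ and $\int_0^T \mathbb E[|z(t)|^p]^{2/p}\,dt<+\infty$. Let $F:[0,T]\times\mathbb R\to\mathbb R$ satisfy: (i) $F(t,\xi)\ge 0$ for all $(t,\xi)$; (ii) $F(t,\xi)$ is twice continuously differentiable in $\xi$ and $\frac{\partial F}{\partial \xi}$, $\frac{\partial^2 F}{\partial \xi^2}$ are continuous functions of both variables; (iii) there exist $\alpha\in(0,p)$ and a non-negative $L\in L^1(0,T)$ such that $|F(t,\xi)|+\left|\frac{\partial F}{\partial \xi}(t,\xi)\right|+\left|\frac{\partial^2 F}{\partial \xi^2}(t,\xi)\right|\le L(t)(1+|\xi|^\alpha)$ for all $t\in[0,T]$, $\xi\in\mathbb R$; (iv) for every fixed $t\in[0,T]$ the function $\xi\mapsto F(t,\xi)$ is convex. Let $\Psi\in\Delta_2$ be a Young function, and suppose there exists $\overline u\in L^\Psi(0,T)$ such that $J[\overline u]=\min_{u\in L^1(0,T)}J[u]$. For each $\delta>0$ let $\overline u_{\delta,\Psi}\in L^1(0,T)$ be a minimizer of $J_{\delta,\Psi}$ over $L^1(0,T)$. Then there exist constants $C,\delta_0>0$ such that $\mathcal F_\Psi[\overline u_{\delta,\Psi}]\le C$ for all $\delta\in(0,\delta_0)$. Moreover, if $\xi\mapsto F(t,\xi)$ is strictly convex for every fixed $t\in[0,T]$, then there is a sequence $\delta_n\to0$ such that $\overline u_{\delta_n,\Psi}\rightharpoonup\overline u$ weakly in $L^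1(0,T)$.
   Context: Fix $T>0$, a filtered probability space $(\Omega,\mathcal F,(\mathcal F_t)_{t\ge 0},\mathbb P)$ and an $\mathcal F_t$-Brownian motion $W$ (started at $0$). $a:[0,T]\to\mathbb R$ is a deterministic function in $L^\infty(0,T)$, $A(t)=\int_0^t a(s)\,ds$, $G(t)=e^{W(t)-t/2}$. $z$ is a real $\mathcal F_t$-adapted, jointly measurable process; $F$ is Borel measurable. $L^1(0,T)$ denotes deterministic integrable real functions (identified when equal a.e.). For $u\in L^1(0,T)$ put $$\xi_u(t)=G(t)e^{A(t)}\int_0^t\frac{e^{-A(s)}}{G(s)}(z(s)-u(s))\,ds,\qquad J[u]=\mathbb E\left[\int_0^T F(t,\xi_u(t))\,dt\right].$$ A Young function is a function $\Psi:[0,+\infty)\to[0,+\infty)$ of the form $\Psi(t)=\int_0^t\psi(s)\,ds$ with $\psi:[0,+\infty)\to[0,+\infty)$, $\psi(0)=0$, $\psi(s)>0$ for $s>0$, $\psi$ right-continuous, non-decreasing, and $\lim_{s\to+\infty}\psi(s)=+\infty$. $\Psi\in\Delta_2$ means there is $k>0$ with $\Psi(2t)\le k\Psi(t)$ for all $t\ge0$. $L^\Psi(0,T)=\{u\in L^1(0,T):\ \exists\lambda>0,\ \int_0^T\Psi(|u(t)|/\lambda)\,dt<+\infty\}$ (for $\Psi\in\Delta_2$ this equals $\{u\in L^1(0,T):\int_0^T\Psi(|u(t)|)\,dt<+\infty\}$). For $u\in L^1(0,T)$ and $\delta>0$, $\mathcal F_\Psi[u]=\int_0^T\Psi(|u(t)|)\,dt\in[0,+\infty]$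 and $J_{\delta,\Psi}[u]=J[u]+\delta\,\mathcal F_\Psi[u]$. Under hypotheses (i)-(iv) of the claim a minimizer of $J_{\delta,\Psi}$ exists for every $\delta>0$. *)

theory Defs
  imports "HOL-Probability.Probability"
begin

section \<open>Filtered probability spaces and Brownian motion\<close>

text \<open>The time index ranges over the nonnegative reals; the values of a filtration or of a process
  at negative times play no role. The usual conditions are not assumed.\<close>

locale filtered_prob_space = prob_space M
  for M :: "'a measure" and Fil :: "real \<Rightarrow> 'a measure" +
  assumes subalg: "\<And>t. 0 \<le> t \<Longrightarrow> subalgebra M (Fil t)"
    and subalg_mono: "\<And>s t. 0 \<le> s \<Longrightarrow> s \<le> t \<Longrightarrow> subalgebra (Fil t) (Fil s)"

text \<open>Initial value and continuity of the paths are only required almost surely.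
  Note that \<^const>\<open>normal_density\<close> takes the standard deviation, not the variance.\<close>

locale brownian_motion = filtered_prob_space M Fil
  for M :: "'a measure" and Fil :: "real \<Rightarrow> 'a measure" +
  fixes W :: "real \<Rightarrow> 'a \<Rightarrow> real"
  assumes adapted: "\<And>t. 0 \<le> t \<Longrightarrow> W t \<in> borel_measurable (Fil t)"
    and start: "AE \<omega> in M. W 0 \<omega> = 0"
    and continuous_paths: "AE \<omega> in M. continuous_on {0..} (\<lambda>t. W t \<omega>)"
    and normal_increments: "\<And>s t. 0 \<le> s \<Longrightarrow> s < t \<Longrightarrow>
      distributed M lborel (\<lambda>\<omega>. W t \<omega> - W s \<omega>) (\<lambda>x. ennreal (normal_density 0 (sqrt (t - s)) x))"
    and indep_increments: "\<And>s t. 0 \<le> s \<Longrightarrow> s < t \<Longrightarrow>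
      indep_set (sets (Fil s)) (sets (vimage_algebra (space M) (\<lambda>\<omega>. W t \<omega> - W s \<omega>) borel))"


section \<open>Deterministic function spaces on the interval\<close>

text \<open>Elements of $L^1(0,T)$ and $L^\infty(0,T)$ are represented by Borel functions
  (every Lebesgue class has a Borel representative). Functions agreeing almost everywhere on
  \<open>{0..T}\<close> are not identified, but everything below depends only on the a.e. class;
  values outside \<open>{0..T}\<close> are irrelevant.\<close>

definition L1 :: "real \<Rightarrow> (real \<Rightarrow> real) set" where
  "L1 T = {u. set_integrable lborel {0..T} u}"

definition Linf :: "real \<Rightarrow> (real \<Rightarrow> real) set" where
  "Linf T = {g. set_borel_measurable lborel {0..T} g \<and>
     (\<exists>K. AE t in lborel. t \<in> {0..T} \<longrightarrow> \<bar>g t\<bar> \<le> K)}"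

text \<open>Weak convergence in $L^1(0,T)$, tested against its dual $L^\infty(0,T)$.\<close>

definition weak_L1_limit :: "real \<Rightarrow> (nat \<Rightarrow> real \<Rightarrow> real) \<Rightarrow> (real \<Rightarrow> real) \<Rightarrow> bool" where
  "weak_L1_limit T v u \<longleftrightarrow> (\<forall>n. v n \<in> L1 T) \<and> u \<in> L1 T \<and>
     (\<forall>g\<in>Linf T. (\<lambda>n. LINT t:{0..T}|lborel. v n t * g t)
        \<longlonglongrightarrow> (LINT t:{0..T}|lborel. u t * g t))"


section \<open>Young functions and Orlicz classes\<close>

text \<open>Functions on $[0,+\infty)$ are total functions whose values at negative arguments are
  irrelevant.\<close>

definition young_function :: "(real \<Rightarrow> real) \<Rightarrow> bool" where
  "young_function \<Psi> \<longleftrightarrow> (\<exists>\<psi> :: real \<Rightarrow> real.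
     \<psi> 0 = 0 \<and> (\<forall>s>0. 0 < \<psi> s) \<and>
     (\<forall>s\<ge>0. continuous (at_right s) \<psi>) \<and> mono_on {0..} \<psi> \<and>
     filterlim \<psi> at_top at_top \<and>
     (\<forall>t\<ge>0. \<Psi> t = (LINT s:{0..t}|lborel. \<psi> s)))"

definition Delta2 :: "(real \<Rightarrow> real) \<Rightarrow> bool" where
  "Delta2 \<Psi> \<longleftrightarrow> (\<exists>k>0. \<forall>t\<ge>0. \<Psi> (2 * t) \<le> k * \<Psi> t)"

definition LPsi :: "real \<Rightarrow> (real \<Rightarrow> real) \<Rightarrow> (real \<Rightarrow> real) set" where
  "LPsi T \<Psi> = {u \<in> L1 T. \<exists>l>0. (\<integral>\<^sup>+t\<in>{0..T}. ennreal (\<Psi> (\<bar>u t\<bar> / l)) \<partial>lborel) < \<infinity>}"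

definition FPsi :: "real \<Rightarrow> (real \<Rightarrow> real) \<Rightarrow> (real \<Rightarrow> real) \<Rightarrow> ennreal" where
  "FPsi T \<Psi> u = (\<integral>\<^sup>+t\<in>{0..T}. ennreal (\<Psi> \<bar>u t\<bar>) \<partial>lborel)"


section \<open>The controlled process and the cost functionals\<close>

definition G :: "(real \<Rightarrow> 'a \<Rightarrow> real) \<Rightarrow> real \<Rightarrow> 'a \<Rightarrow> real" where
  "G W t \<omega> = exp (W t \<omega> - t / 2)"

definition A :: "(real \<Rightarrow> real) \<Rightarrow> real \<Rightarrow> real" where
  "A a t = (LINT s:{0..t}|lborel. a s)"

text \<open>The pathwise integral is a Bochner integral, hence $0$ on the null set of those \<open>\<omega>\<close> for which
  the integrand is not integrable.\<close>

definition \<xi> :: "(real \<Rightarrow> real) \<Rightarrow> (real \<Rightarrow> 'a \<Rightarrow> real) \<Rightarrow> (real \<Rightarrow> 'a \<Rightarrow> real)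
    \<Rightarrow> (real \<Rightarrow> real) \<Rightarrow> real \<Rightarrow> 'a \<Rightarrow> real" where
  "\<xi> a W z u t \<omega> = G W t \<omega> * exp (A a t) *
     (LINT s:{0..t}|lborel. exp (- A a s) / G W s \<omega> * (z s \<omega> - u s))"

text \<open>The cost is only used for nonnegative \<open>F\<close>, so it is a well-defined element of $[0,+\infty]$;
  the coercion \<^const>\<open>ennreal\<close> would cut off negative values of \<open>F\<close>.\<close>

definition J :: "'a measure \<Rightarrow> real \<Rightarrow> (real \<Rightarrow> real) \<Rightarrow> (real \<Rightarrow> 'a \<Rightarrow> real) \<Rightarrow> (real \<Rightarrow> 'a \<Rightarrow> real)
    \<Rightarrow> (real \<Rightarrow> real \<Rightarrow> real) \<Rightarrow> (real \<Rightarrow> real) \<Rightarrow> ennreal" where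
  "J M T a W z F u =
     (\<integral>\<^sup>+\<omega>. (\<integral>\<^sup>+t\<in>{0..T}. ennreal (F t (\<xi> a W z u t \<omega>)) \<partial>lborel) \<partial>M)"

definition J_pen :: "'a measure \<Rightarrow> real \<Rightarrow> (real \<Rightarrow> real) \<Rightarrow> (real \<Rightarrow> 'a \<Rightarrow> real) \<Rightarrow> (real \<Rightarrow> 'a \<Rightarrow> real)
    \<Rightarrow> (real \<Rightarrow> real \<Rightarrow> real) \<Rightarrow> (real \<Rightarrow> real) \<Rightarrow> real \<Rightarrow> (real \<Rightarrow> real) \<Rightarrow> ennreal" where
  "J_pen M T a W z F \<Psi> \<delta> u = J M T a W z F u + ennreal \<delta> * FPsi T \<Psi> u"

definition strictly_convex :: "(real \<Rightarrow> real) \<Rightarrow> bool" where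
  "strictly_convex f \<longleftrightarrow> (\<forall>x y r. x \<noteq> y \<longrightarrow> 0 < r \<longrightarrow> r < 1 \<longrightarrow>
     f ((1 - r) * x + r * y) < (1 - r) * f x + r * f y)"

end

theory Submission
  imports Defs
begin

text \<open>
  Let \<open>v\<close> be the minimizer of the unpenalized cost and \<open>u\<^sub>n\<close> the penalized minimizer for
  \<open>\<delta>\<^sub>n = 2 ^ - n\<close>, and write \<open>\<Phi>\<close> for the penalty. Comparing the two minimality properties gives
  \<open>J u\<^sub>n + \<delta>\<^sub>n \<Phi> u\<^sub>n \<le> J v + \<delta>\<^sub>n \<Phi> v \<le> J u\<^sub>n + \<delta>\<^sub>n \<Phi> v\<close>. As soon as \<open>J v\<close> is finite, this yields both
  \<open>\<Phi> u\<^sub>n \<le> \<Phi> v\<close>, which is the first claim because \<open>\<Delta>\<^sub>2\<close> makes \<open>\<Phi> v\<close> finite, and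
  \<open>J u\<^sub>n \<le> J v + \<delta>\<^sub>n \<Phi> v\<close>.

  Finiteness of \<open>J v\<close> follows from \<open>J 0 < \<infinity>\<close> (\<open>J_zero_finite\<close>). With zero control the state is bounded, up to a
  constant, by the integral over \<open>s\<close> of \<open>exp (W t - W s) * \<bar>z s\<bar>\<close>. The increment is independent of \<open>z s\<close>, so the \<open>p\<close>-th
  moment of the integrand is a constant times that of \<open>z s\<close> (\<open>nn_integral_exp_increment_mult\<close>), and a
  pathwise Hoelder inequality with a deterministic weight (\<open>weighted_hoelder\<close>) turns this into a bound
  on the \<open>p\<close>-th moment of the state that is uniform in time.

  The weak convergence comes from pointwise convergence of the states. The control enters the state
  affinely, so the state of the midpoint control \<open>(u\<^sub>n + v) / 2\<close> is the midpoint of the states. Hence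
  the integral of the convexity defect of \<open>F\<close> at the states of \<open>u\<^sub>n\<close> and \<open>v\<close> equals
  \<open>(J u\<^sub>n + J v) / 2\<close> minus the cost of the midpoint, which is at most \<open>\<delta>\<^sub>n \<Phi> v / 2\<close>. These bounds are
  summable, so the defects tend to \<open>0\<close> almost everywhere, and strict convexity forces the states to
  converge almost everywhere (\<open>minimizing_sequence_state_converges\<close>).

  Now a single good \<open>\<omega>\<close> suffices. Convergence of the states along that path says that
  the primitives of \<open>h * (u\<^sub>n - v)\<close> converge to \<open>0\<close> at almost every time, where \<open>h\<close> is a fixed function on
  \<open>{0..T}\<close> bounded and bounded away from \<open>0\<close>. The bound on \<open>\<Phi> u\<^sub>n\<close> and the superlinear growth of \<open>\<Psi>\<close> make
  these functions uniformly integrable, which upgrades convergence of primitives to convergence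
  against every bounded test function (\<open>unif_integrable_weak_null\<close>). Testing with \<open>g / h\<close> gives the
  weak convergence of \<open>u\<^sub>n\<close> to \<open>v\<close> (\<open>state_converges_imp_weak_limit\<close>).
\<close>

section \<open>Moment inequalities\<close>

lemma powr_tangent:
  fixes x c p :: real
  assumes "0 \<le> x" "0 \<le> c" "1 \<le> p"
  shows "c powr p + p * c powr (p - 1) * (x - c) \<le> x powr p"
proof (cases "c = 0 \<or> x = 0")
  case True
  then show ?thesis
  proof
    assume "c = 0" then show ?thesis using assms by simp
  next
    assume x: "x = 0"
    have "c powr (p - 1) * c = c powr p"
      by (cases "c = 0") (use assms in \<open>auto simp: powr_diff\<close>)
    then have "c powr p + p * c powr (p - 1) * (x - c) = (1 - p) * c powr p"
      using x by (simp add: algebra_simps)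
    also have "\<dots> \<le> 0" using assms by (simp add: mult_le_0_iff)
    finally show ?thesis using x by simp
  qed
next
  case False
  then have "0 < c" "0 < x" using assms by auto
  have "p * c powr (p - 1) * (x - c) \<le> x powr p - c powr p"
  proof (rule convex_on_imp_above_tangent[where A="{0<..}"])
    show "convex_on {0<..} (\<lambda>x. x powr p)" by (rule powr_convex) fact
    show "c \<in> interior {0<..}" using \<open>0 < c\<close> by (simp add: interior_open)
    show "((\<lambda>x. x powr p) has_real_derivative p * c powr (p - 1)) (at c within {0<..})"
      using \<open>0 < c\<close> by (auto intro!: derivative_eq_intros)
  qed (use \<open>0 < x\<close> in auto)
  then show ?thesis by simp
qed

text \<open>Integrals on the left are Bochner integrals, equal to \<open>0\<close> when \<open>f\<close> is not integrable, while the right-hand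
  side may be infinite; this is what allows a pathwise use without knowing that the path is
  integrable. The proof integrates the tangent inequality for \<open>x powr p\<close> at the \<open>m\<close>-weighted mean of \<open>f / m\<close>,
  that is, it is Jensen's inequality for the measure with density \<open>m\<close>.\<close>

lemma weighted_hoelder:
  fixes m f :: "'a \<Rightarrow> real"
  assumes p: "1 \<le> p" and m: "integrable N m" "\<And>x. 0 < m x"
    and f: "f \<in> borel_measurable N" "\<And>x. 0 \<le> f x"
  shows "ennreal ((\<integral>x. f x \<partial>N) powr p)
    \<le> ennreal ((\<integral>x. m x \<partial>N) powr (p - 1)) * (\<integral>\<^sup>+x. ennreal (m x powr (1 - p) * f x powr p) \<partial>N)"
proof (cases "(\<integral>x. f x \<partial>N) = 0")
  case True
  then show ?thesis using p by simp
next
  case False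
  then have fi: "integrable N f" and fpos: "0 < (\<integral>x. f x \<partial>N)"
    using not_integrable_integral_eq[of N f] integral_nonneg_AE[of f N] f(2) by (auto simp: order_less_le)
  define K where "K = (\<integral>x. m x \<partial>N)"
  have "K \<noteq> 0"
  proof
    assume "K = 0"
    then have "AE x in N. m x = 0"
      unfolding K_def using integral_nonneg_eq_0_iff_AE[OF m(1)] m(2) by (simp add: less_imp_le)
    then have "AE x in N. False" by eventually_elim (use m(2) less_irrefl in metis)
    then have "(\<integral>x. f x \<partial>N) = (\<integral>x. 0 \<partial>N)" using f(1) by (intro integral_cong_AE) auto
    with False show False by simp
  qed
  moreover have "0 \<le> K" unfolding K_def by (intro integral_nonneg_AE) (use m(2) in \<open>auto intro!: AE_I2 less_imp_le\<close>)
  ultimately have K: "0 < K" by simp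
  have [measurable]: "m \<in> borel_measurable N" "f \<in> borel_measurable N" using m f by auto
  let ?g = "\<lambda>x. m x powr (1 - p) * f x powr p"
  let ?I = "\<integral>x. f x \<partial>N"
  define c where "c = ?I / K"
  have c: "0 < c" using fpos K by (simp add: c_def)
  show ?thesis
  proof (cases "integrable N ?g")
    case True
    have pt: "m x * c powr p + p * c powr (p - 1) * (f x - c * m x) \<le> ?g x" for x
    proof -
      have "c powr p + p * c powr (p - 1) * (f x / m x - c) \<le> (f x / m x) powr p"
        by (rule powr_tangent) (use p c m(2)[of x] f(2)[of x] in auto)
      then have "m x * (c powr p + p * c powr (p - 1) * (f x / m x - c)) \<le> m x * (f x / m x) powr p"
        using m(2)[of x] by simp
      moreover have "m x * (f x / m x) powr p = ?g x"
        using m(2)[of x] f(2)[of x] by (simp add: powr_divide powr_diff)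
      moreover have "m x * (c powr p + p * c powr (p - 1) * (f x / m x - c))
          = m x * c powr p + p * c powr (p - 1) * (f x - c * m x)"
        using m(2)[of x] by (simp add: field_simps)
      ultimately show ?thesis by simp
    qed
    have "K * c powr p + p * c powr (p - 1) * (?I - c * K)
        = (\<integral>x. m x * c powr p + p * c powr (p - 1) * (f x - c * m x) \<partial>N)"
      using m(1) fi by (simp add: K_def)
    also have "\<dots> \<le> (\<integral>x. ?g x \<partial>N)"
      by (intro integral_mono_AE) (use m(1) fi True pt in auto)
    finally have "K * c powr p \<le> (\<integral>x. ?g x \<partial>N)" using K by (simp add: c_def)
    then have "K powr (p - 1) * (K * c powr p) \<le> K powr (p - 1) * (\<integral>x. ?g x \<partial>N)"
      by (intro mult_left_mono) auto
    moreover have "K powr (p - 1) * (K * c powr p) = ?I powr p"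
      using K fpos by (simp add: c_def powr_divide powr_diff)
    ultimately have "ennreal (?I powr p) \<le> ennreal (K powr (p - 1) * (\<integral>x. ?g x \<partial>N))"
      by (intro ennreal_leI) simp
    also have "\<dots> = ennreal (K powr (p - 1)) * (\<integral>\<^sup>+x. ennreal (?g x) \<partial>N)"
      by (subst nn_integral_eq_integral[OF True]) (auto simp: ennreal_mult')
    finally show ?thesis unfolding K_def .
  next
    case False
    have "(\<integral>\<^sup>+x. ennreal (?g x) \<partial>N) = \<infinity>"
    proof (rule ccontr)
      assume "\<not> ?thesis"
      then have "integrable N ?g" by (intro integrableI_nonneg) (auto simp: less_top)
      with False show False by simp
    qed
    then show ?thesis using K by (simp add: K_def[symmetric] ennreal_mult_top)
  qed
qed

lemma le_add_weighted_powr: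
  fixes x m p :: real
  assumes "0 \<le> x" "0 < m" "1 \<le> p"
  shows "x \<le> m + m powr (1 - p) * x powr p"
proof (cases "x \<le> m")
  case False
  then have "1 \<le> x / m" using assms by simp
  then have "x / m \<le> (x / m) powr p" using powr_mono[of 1 p "x / m"] assms by simp
  then have "x \<le> m * (x / m) powr p" using assms by (simp add: field_simps)
  also have "\<dots> = m powr (1 - p) * x powr p" using assms by (simp add: powr_divide powr_diff)
  finally show ?thesis using assms by simp
qed (use assms in \<open>simp add: add_increasing2\<close>)

text \<open>Completing the square: tilting a centred normal density by \<open>exp (c * x)\<close> shifts its mean to \<open>c * \<sigma>\<^sup>2\<close>.\<close>

lemma nn_integral_normal_exp:
  assumes "0 < \<sigma>"
  shows "(\<integral>\<^sup>+x. ennreal (normal_density 0 \<sigma> x) * ennreal (exp (c * x)) \<partial>lborel) = ennreal (exp (c\<^sup>2 * \<sigma>\<^sup>2 / 2))"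
proof -
  have "normal_density 0 \<sigma> x * exp (c * x) = exp (c\<^sup>2 * \<sigma>\<^sup>2 / 2) * normal_density (c * \<sigma>\<^sup>2) \<sigma> x" for x
  proof -
    have "- x\<^sup>2 / (2 * \<sigma>\<^sup>2) + c * x = c\<^sup>2 * \<sigma>\<^sup>2 / 2 + - (x - c * \<sigma>\<^sup>2)\<^sup>2 / (2 * \<sigma>\<^sup>2)"
      using assms by (simp add: field_simps power2_eq_square)
    then have "exp (- x\<^sup>2 / (2 * \<sigma>\<^sup>2)) * exp (c * x)
        = exp (c\<^sup>2 * \<sigma>\<^sup>2 / 2) * exp (- (x - c * \<sigma>\<^sup>2)\<^sup>2 / (2 * \<sigma>\<^sup>2))"
      by (simp add: exp_add[symmetric])
    then show ?thesis by (simp add: normal_density_def)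
  qed
  then have "(\<integral>\<^sup>+x. ennreal (normal_density 0 \<sigma> x) * ennreal (exp (c * x)) \<partial>lborel)
      = (\<integral>\<^sup>+x. ennreal (exp (c\<^sup>2 * \<sigma>\<^sup>2 / 2)) * ennreal (normal_density (c * \<sigma>\<^sup>2) \<sigma> x) \<partial>lborel)"
    by (simp add: ennreal_mult'[symmetric] del: ennreal_mult')
  also have "\<dots> = ennreal (exp (c\<^sup>2 * \<sigma>\<^sup>2 / 2)) * ennreal 1"
    using integral_normal_density[OF assms, of "c * \<sigma>\<^sup>2"] integrable_normal_density[OF assms, of "c * \<sigma>\<^sup>2"]
    by (subst nn_integral_cmult) (auto simp: nn_integral_eq_integral)
  finally show ?thesis by simp
qed

text \<open>The increment is independent of the past up to \<open>s\<close>, so the integral factorizes; the first factor is a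
  moment of a lognormal variable.\<close>

lemma (in brownian_motion) nn_integral_exp_increment_mult:
  fixes Y :: "'a \<Rightarrow> ennreal"
  assumes s: "0 \<le> s" "s \<le> t" and Y: "Y \<in> borel_measurable (Fil s)"
  shows "(\<integral>\<^sup>+\<omega>. ennreal (exp (c * (W t \<omega> - W s \<omega>))) * Y \<omega> \<partial>M)
    = ennreal (exp (c\<^sup>2 * (t - s) / 2)) * (\<integral>\<^sup>+\<omega>. Y \<omega> \<partial>M)"
proof (cases "s = t")
  case False
  then have st: "s < t" using s by simp
  define D where "D = (\<lambda>\<omega>. W t \<omega> - W s \<omega>)"
  define X where "X = (\<lambda>\<omega>. ennreal (exp (c * D \<omega>)))"
  note dist = normal_increments[OF s(1) st, folded D_def]
  have D[measurable]: "D \<in> borel_measurable M" using distributed_measurable[OF dist] by simp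
  have YM: "Y \<in> borel_measurable M" by (rule measurable_from_subalg[OF subalg[OF s(1)] Y])
  have XM: "X \<in> borel_measurable M" unfolding X_def by simp
  have sub: "space (Fil s) = space M" using subalg[OF s(1)] by (simp add: subalgebra_def)
  have "sigma_sets (space M) {Y -` B \<inter> space M |B. B \<in> sets borel} \<subseteq> sets (Fil s)"
    using measurable_sets[OF Y] sub by (intro sets.sigma_sets_subset[of _ "Fil s", unfolded sub]) auto
  moreover have "sigma_sets (space M) {X -` B \<inter> space M |B. B \<in> sets borel}
      \<subseteq> sets (vimage_algebra (space M) D borel)"
  proof -
    have "X \<in> borel_measurable (vimage_algebra (space M) D borel)"
      unfolding X_def by (intro measurable_compose[OF measurable_vimage_algebra1]) auto
    from measurable_sets[OF this] show ?thesis
      by (intro sets.sigma_sets_subset[of _ "vimage_algebra (space M) D borel", simplified]) auto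
  qed
  ultimately have "indep_set (sigma_sets (space M) {Y -` B \<inter> space M |B. B \<in> sets borel})
      (sigma_sets (space M) {X -` B \<inter> space M |B. B \<in> sets borel})"
    using indep_increments[OF s(1) st, folded D_def] unfolding indep_sets2_eq by (meson subset_eq)
  with YM XM have "indep_var borel Y borel X" unfolding indep_var_eq by blast
  then have "indep_vars (\<lambda>_. borel) (case_bool Y X) UNIV"
    unfolding indep_var_def bool.case_distrib[symmetric]
    by (simp add: case_bool_if)
  then have "(\<integral>\<^sup>+\<omega>. (\<Prod>i\<in>UNIV. case_bool Y X i \<omega>) \<partial>M) = (\<Prod>i\<in>UNIV. \<integral>\<^sup>+\<omega>. case_bool Y X i \<omega> \<partial>M)"
    by (intro indep_vars_nn_integral) auto
  then have "(\<integral>\<^sup>+\<omega>. X \<omega> * Y \<omega> \<partial>M) = (\<integral>\<^sup>+\<omega>. X \<omega> \<partial>M) * (\<integral>\<^sup>+\<omega>. Y \<omega> \<partial>M)"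
    by (simp add: UNIV_bool mult.commute)
  moreover have "(\<integral>\<^sup>+\<omega>. X \<omega> \<partial>M) = ennreal (exp (c\<^sup>2 * (t - s) / 2))"
    unfolding X_def using nn_integral_normal_exp[of "sqrt (t - s)" c] st
    by (subst distributed_nn_integral[OF dist, symmetric]) auto
  ultimately show ?thesis by (simp add: X_def D_def)
qed simp

section \<open>Joint measurability of continuous processes\<close>

text \<open>Sampling the process on the grids \<open>\<lfloor>n t\<rfloor> / n\<close> gives jointly measurable processes that converge by
  continuity of the paths.\<close>

lemma borel_measurable_continuous_process:
  fixes X :: "real \<Rightarrow> 'a \<Rightarrow> real"
  assumes X: "\<And>t. X t \<in> borel_measurable N"
    and cont: "\<And>\<omega>. \<omega> \<in> space N \<Longrightarrow> continuous_on UNIV (\<lambda>t. X t \<omega>)"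
  shows "(\<lambda>(t, \<omega>). X t \<omega>) \<in> borel_measurable (borel \<Otimes>\<^sub>M N)"
proof (rule borel_measurable_LIMSEQ_real)
  let ?q = "\<lambda>n t. of_int \<lfloor>real (Suc n) * t\<rfloor> / real (Suc n)"
  show "(\<lambda>(t, \<omega>). X (?q n t) \<omega>) \<in> borel_measurable (borel \<Otimes>\<^sub>M N)" for n
  proof -
    have "(\<lambda>x. (\<lambda>i x. X (of_int i / real (Suc n)) (snd x)) \<lfloor>real (Suc n) * fst x\<rfloor> x)
        \<in> borel_measurable (borel \<Otimes>\<^sub>M N)"
      by (rule measurable_compose_countable) (use X in measurable)
    then show ?thesis by (simp add: case_prod_beta)
  qed
  fix x :: "real \<times> 'a" assume x: "x \<in> space (borel \<Otimes>\<^sub>M N)"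
  obtain t \<omega> where tw: "x = (t, \<omega>)" by (cases x)
  then have w: "\<omega> \<in> space N" using x by (simp add: space_pair_measure)
  have "(\<lambda>n. ?q n t) \<longlonglongrightarrow> t"
  proof (rule real_tendsto_sandwich)
    show "\<forall>\<^sub>F n in sequentially. t - 1 / real (Suc n) \<le> ?q n t"
    proof (intro always_eventually allI)
      fix n
      have "(t - 1 / real (Suc n)) * real (Suc n) = real (Suc n) * t - 1" by (simp add: field_simps)
      also have "\<dots> \<le> of_int \<lfloor>real (Suc n) * t\<rfloor>" by linarith
      finally show "t - 1 / real (Suc n) \<le> ?q n t" by (simp add: field_simps del: of_nat_Suc)
    qed
    show "\<forall>\<^sub>F n in sequentially. ?q n t \<le> t"
      by (intro always_eventually allI) (simp add: divide_le_eq mult.commute del: of_nat_Suc)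
    have "(\<lambda>n. 1 / real (Suc n)) \<longlonglongrightarrow> 0" using LIMSEQ_inverse_real_of_nat by (simp add: inverse_eq_divide)
    from tendsto_diff[OF tendsto_const[of t] this] show "(\<lambda>n. t - 1 / real (Suc n)) \<longlonglongrightarrow> t" by simp
  qed auto
  moreover have "isCont (\<lambda>t. X t \<omega>) t" using cont[OF w] by (simp add: continuous_on_eq_continuous_at)
  ultimately show "(\<lambda>n. case x of (t, \<omega>) \<Rightarrow> X (?q n t) \<omega>) \<longlonglongrightarrow> (case x of (t, \<omega>) \<Rightarrow> X t \<omega>)"
    unfolding tw prod.case by (rule isCont_tendsto_compose[rotated])
qed

section \<open>The midpoint defect of a convex function\<close>

text \<open>The midpoint convexity defect between \<open>c\<close> and \<open>y\<close> grows as \<open>y\<close> moves away from \<open>c\<close>: both \<open>c + l * d\<close> and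
  \<open>c + d / 2\<close> lie between \<open>c + l * d / 2\<close> and \<open>c + d\<close>, and adding the two convexity inequalities gives the
  claim.\<close>

lemma midpoint_gap_mono:
  fixes f :: "real \<Rightarrow> real"
  assumes f: "convex_on UNIV f" and l: "0 < l" "l \<le> 1"
  shows "(f (c + l * d) + f c) / 2 - f (c + l * d / 2) \<le> (f (c + d) + f c) / 2 - f (c + d / 2)"
proof -
  define P where "P = c + l * d / 2"
  define k1 where "k1 = (l / 2) / (1 - l / 2)"
  define k2 where "k2 = (1 / 2 - l / 2) / (1 - l / 2)"
  have pos: "0 < 1 - l / 2" using l by simp
  have k: "0 \<le> k1" "k1 \<le> 1" "0 \<le> k2" "k2 \<le> 1"
    using l pos unfolding k1_def k2_def by (auto simp: divide_simps)
  have "k1 / 2 + k2 = ((l / 2) / 2 + (1 / 2 - l / 2)) / (1 - l / 2)"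
    unfolding k1_def k2_def by (simp only: add_divide_distrib times_divide_eq_left divide_divide_eq_left mult.commute)
  also have "(l / 2) / 2 + (1 / 2 - l / 2) = 1 / 2 * (1 - l / 2)" by (simp add: field_simps)
  finally have k_sum: "k1 / 2 + k2 = 1 / 2" using pos by simp
  have e1: "c + l * d = (1 - k1) * P + k1 * (c + d)" and e2: "c + d / 2 = (1 - k2) * P + k2 * (c + d)"
  proof -
    have "x / (1 - l / 2) * (1 - l / 2) = x" for x :: real
      using pos by (metis less_irrefl nonzero_mult_div_cancel_right times_divide_eq_left)
    then have "k1 * (1 - l / 2) = l / 2" "k2 * (1 - l / 2) = 1 / 2 - l / 2"
      by (simp_all only: k1_def k2_def)
    moreover have "(1 - k1) * P + k1 * (c + d) = c + d * (l / 2 + k1 * (1 - l / 2))"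
      "(1 - k2) * P + k2 * (c + d) = c + d * (l / 2 + k2 * (1 - l / 2))"
      unfolding P_def by (simp_all add: algebra_simps add_divide_distrib diff_divide_distrib)
    ultimately have "(1 - k1) * P + k1 * (c + d) = c + d * (l / 2 + l / 2)"
      "(1 - k2) * P + k2 * (c + d) = c + d * (l / 2 + (1 / 2 - l / 2))"
      by (simp_all only:)
    then show "c + l * d = (1 - k1) * P + k1 * (c + d)" "c + d / 2 = (1 - k2) * P + k2 * (c + d)"
      by simp_all
  qed
  have "f (c + l * d) \<le> (1 - k1) * f P + k1 * f (c + d)"
    unfolding e1 using convex_onD[OF f, of k1 P "c + d"] k by simp
  moreover have "f (c + d / 2) \<le> (1 - k2) * f P + k2 * f (c + d)"
    unfolding e2 using convex_onD[OF f, of k2 P "c + d"] k by simp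
  ultimately have "f (c + l * d) / 2 + f (c + d / 2)
      \<le> ((1 - k1) / 2 + (1 - k2)) * f P + (k1 / 2 + k2) * f (c + d)"
    by (simp add: field_simps)
  also have "(1 - k1) / 2 + (1 - k2) = 1" using k_sum by (simp add: field_simps)
  finally have "f (c + l * d) / 2 + f (c + d / 2) \<le> 1 * f P + 1 / 2 * f (c + d)" unfolding k_sum .
  then show ?thesis by (simp add: P_def add_divide_distrib)
qed

text \<open>By monotonicity the defect at distance at least \<open>e\<close> from \<open>c\<close> is bounded below by the smaller of its values
  at \<open>c + e\<close> and \<open>c - e\<close>, and these are positive by strict convexity.\<close>

lemma midpoint_gap_tendsto_zero:
  fixes f :: "real \<Rightarrow> real"
  assumes f: "convex_on UNIV f" "strictly_convex f"
    and lim: "(\<lambda>n. (f (x n) + f c) / 2 - f ((x n + c) / 2)) \<longlonglongrightarrow> 0"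
  shows "x \<longlonglongrightarrow> c"
proof (rule LIMSEQ_I)
  fix e :: real assume e: "0 < e"
  let ?g = "\<lambda>y. (f y + f c) / 2 - f ((y + c) / 2)"
  have gpos: "0 < ?g y" if "y \<noteq> c" for y
  proof -
    have "f ((1 - 1/2) * y + 1/2 * c) < (1 - 1/2) * f y + 1/2 * f c"
      using f(2)[unfolded strictly_convex_def, rule_format, OF that, of "1/2"] by simp
    then show ?thesis by (simp add: field_simps)
  qed
  define r where "r = min (?g (c + e)) (?g (c - e))"
  have "0 < r" unfolding r_def using gpos[of "c + e"] gpos[of "c - e"] e by (simp only: min_less_iff_conj)
  from LIMSEQ_D[OF lim this] obtain n0 where n0: "\<And>n. n \<ge> n0 \<Longrightarrow> norm (?g (x n) - 0) < r" by blast
  have "norm (x n - c) < e" if "n \<ge> n0" for n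
  proof (rule ccontr)
    assume "\<not> ?thesis"
    then have ge: "e \<le> \<bar>x n - c\<bar>" by simp
    define d where "d = x n - c"
    define l where "l = e / \<bar>d\<bar>"
    have l: "0 < l" "l \<le> 1" "l * \<bar>d\<bar> = e" using ge e by (auto simp: l_def d_def)
    have mid: "(c + l * d + c) / 2 = c + l * d / 2" "(x n + c) / 2 = c + d / 2" "x n = c + d"
      by (simp_all add: d_def field_simps)
    have "?g (c + l * d) \<le> ?g (x n)"
      using midpoint_gap_mono[OF f(1) l(1,2), of c d] unfolding mid(1,2) by (simp only: mid(3))
    moreover have "l * d = e \<or> l * d = - e" using l(3) by (cases "0 \<le> d") auto
    then have "c + l * d = c + e \<or> c + l * d = c - e" by auto
    ultimately have "r \<le> ?g (x n)" unfolding r_def by (elim disjE) (simp_all only: min_le_iff_disj simp_thms)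
    then show False using n0[OF that] by simp
  qed
  then show "\<exists>n0. \<forall>n\<ge>n0. norm (x n - c) < e" by blast
qed

section \<open>Uniform integrability and weak convergence to zero\<close>

text \<open>The assumption \<open>ui\<close> is uniform integrability in the form of a domination by one integrable function up
  to an error of small integral. It lets dominated convergence act uniformly in \<open>n\<close>, so the class of
  bounded test functions against which \<open>w\<close> tends weakly to \<open>0\<close> is closed under bounded pointwise limits.\<close>

lemma unif_integrable_bounded_convergence:
  fixes w :: "nat \<Rightarrow> 'a \<Rightarrow> real" and g :: "nat \<Rightarrow> 'a \<Rightarrow> real"
  assumes w: "\<And>n. integrable N (w n)"
    and ui: "\<And>e. 0 < e \<Longrightarrow> \<exists>k. integrable N k \<and>
      (\<forall>n. \<exists>r. integrable N r \<and> (\<forall>x. 0 \<le> r x) \<and> (\<forall>x. \<bar>w n x\<bar> \<le> k x + r x) \<and> (\<integral>x. r x \<partial>N) \<le> e)"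
    and g: "\<And>i. g i \<in> borel_measurable N" "\<And>i x. \<bar>g i x\<bar> \<le> K"
    and h: "h \<in> borel_measurable N" "\<And>x. x \<in> space N \<Longrightarrow> (\<lambda>i. g i x) \<longlonglongrightarrow> h x"
    and conv: "\<And>i. (\<lambda>n. \<integral>x. w n x * g i x \<partial>N) \<longlonglongrightarrow> 0"
  shows "(\<lambda>n. \<integral>x. w n x * h x \<partial>N) \<longlonglongrightarrow> 0"
proof (rule LIMSEQ_I)
  fix e :: real assume e: "0 < e"
  have K: "0 \<le> K" using g(2) abs_ge_zero order_trans by blast
  \<comment> \<open>The deviations \<open>h - g i\<close> are bounded by \<open>2 * K\<close>, so remainders of integral at most \<open>e'\<close> cost \<open>e / 4\<close>.\<close>
  define e' where "e' = e / (8 * (K + 1))"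
  have e': "0 < e'" "2 * K * e' \<le> e / 4"
    using e K by (auto simp: e'_def field_simps)
  obtain k where k: "integrable N k" and "\<forall>n. \<exists>r. integrable N r \<and> (\<forall>x. 0 \<le> r x)
      \<and> (\<forall>x. \<bar>w n x\<bar> \<le> k x + r x) \<and> (\<integral>x. r x \<partial>N) \<le> e'"
    using ui[OF e'(1)] by blast
  then obtain r where r: "\<And>n. integrable N (r n)" "\<And>n x. 0 \<le> r n x"
      "\<And>n x. \<bar>w n x\<bar> \<le> k x + r n x" "\<And>n. (\<integral>x. r n x \<partial>N) \<le> e'"
    by metis
  have [measurable]: "\<And>i. g i \<in> borel_measurable N" "h \<in> borel_measurable N" "k \<in> borel_measurable N"
    "\<And>n. w n \<in> borel_measurable N" using g h k w by auto
  have hK: "\<bar>h x\<bar> \<le> K" if "x \<in> space N" for x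
    using tendsto_rabs[OF h(2)[OF that]] g(2) by (intro LIMSEQ_le_const2) auto
  have diff: "\<bar>h x - g i x\<bar> \<le> 2 * K" if "x \<in> space N" for i x
    using hK[OF that] g(2)[of i x] by linarith
  have int_b: "integrable N (\<lambda>x. f x * q x)" if "integrable N f" "q \<in> borel_measurable N"
      "\<And>x. x \<in> space N \<Longrightarrow> \<bar>q x\<bar> \<le> B" for f q :: "'a \<Rightarrow> real" and B
  proof (rule Bochner_Integration.integrable_bound)
    show "integrable N (\<lambda>x. B * f x)" using that(1) by simp
    show "AE x in N. norm (f x * q x) \<le> norm (B * f x)"
    proof (intro AE_I2)
      fix x assume "x \<in> space N"
      then have "\<bar>q x\<bar> \<le> \<bar>B\<bar>" using that(3)[of x] by simp
      from mult_left_mono[OF this abs_ge_zero[of "f x"]]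
      show "norm (f x * q x) \<le> norm (B * f x)" by (simp add: abs_mult mult.commute)
    qed
  qed (use that in measurable)
  have "(\<lambda>i. \<integral>x. k x * \<bar>h x - g i x\<bar> \<partial>N) \<longlonglongrightarrow> (\<integral>x. 0 \<partial>N)"
  proof (rule integral_dominated_convergence[where w="\<lambda>x. 2 * K * \<bar>k x\<bar>"])
    show "AE x in N. (\<lambda>i. k x * \<bar>h x - g i x\<bar>) \<longlonglongrightarrow> 0"
    proof (intro AE_I2)
      fix x assume "x \<in> space N"
      from tendsto_mult_right_zero[OF tendsto_rabs_zero[OF LIM_zero[OF h(2)[OF this]]], of "k x"]
      show "(\<lambda>i. k x * \<bar>h x - g i x\<bar>) \<longlonglongrightarrow> 0" by (simp add: abs_minus_commute)
    qed
    show "AE x in N. norm (k x * \<bar>h x - g i x\<bar>) \<le> 2 * K * \<bar>k x\<bar>" for i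
      using diff by (intro AE_I2) (auto simp: abs_mult mult.commute intro!: mult_left_mono)
  qed (use k in auto)
  then have "(\<lambda>i. \<integral>x. k x * \<bar>h x - g i x\<bar> \<partial>N) \<longlonglongrightarrow> 0" by simp
  from LIMSEQ_D[OF this, of "e / 4"] e obtain i where "norm ((\<integral>x. k x * \<bar>h x - g i x\<bar> \<partial>N) - 0) < e / 4"
    by fastforce
  then have i: "(\<integral>x. k x * \<bar>h x - g i x\<bar> \<partial>N) < e / 4" by simp
  from LIMSEQ_D[OF conv[of i], of "e / 4"] e obtain n0
    where n0: "\<And>n. n \<ge> n0 \<Longrightarrow> \<bar>\<integral>x. w n x * g i x \<partial>N\<bar> < e / 4" by auto
  have "norm ((\<integral>x. w n x * h x \<partial>N) - 0) < e" if n: "n \<ge> n0" for n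
  proof -
    have wh: "integrable N (\<lambda>x. w n x * h x)" by (rule int_b[OF w _ hK]) auto
    have wg: "integrable N (\<lambda>x. w n x * g i x)" by (rule int_b[OF w _ g(2)]) auto
    have kd: "integrable N (\<lambda>x. k x * \<bar>h x - g i x\<bar>)"
      by (rule int_b[OF k, where B="2 * K"]) (use diff in auto)
    have "\<bar>(\<integral>x. w n x * h x \<partial>N) - (\<integral>x. w n x * g i x \<partial>N)\<bar> = \<bar>\<integral>x. w n x * h x - w n x * g i x \<partial>N\<bar>"
      using wh wg by simp
    also have "\<dots> \<le> (\<integral>x. \<bar>w n x * h x - w n x * g i x\<bar> \<partial>N)" by (rule integral_abs_bound)
    also have "\<dots> \<le> (\<integral>x. k x * \<bar>h x - g i x\<bar> + 2 * K * r n x \<partial>N)"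
    proof (intro integral_mono)
      fix x assume x: "x \<in> space N"
      have "\<bar>w n x * h x - w n x * g i x\<bar> = \<bar>w n x\<bar> * \<bar>h x - g i x\<bar>"
        by (simp add: right_diff_distrib[symmetric] abs_mult)
      also have "\<dots> \<le> (k x + r n x) * \<bar>h x - g i x\<bar>" by (intro mult_right_mono r) auto
      also have "\<dots> \<le> k x * \<bar>h x - g i x\<bar> + r n x * (2 * K)"
        using mult_left_mono[OF diff[OF x, of i] r(2)[of n x]] by (simp add: distrib_right)
      finally show "\<bar>w n x * h x - w n x * g i x\<bar> \<le> k x * \<bar>h x - g i x\<bar> + 2 * K * r n x"
        by (simp only: ac_simps)
    qed (use wh wg kd r(1) in auto)
    also have "\<dots> = (\<integral>x. k x * \<bar>h x - g i x\<bar> \<partial>N) + 2 * K * (\<integral>x. r n x \<partial>N)"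
      using kd r(1) by simp
    also have "\<dots> \<le> e / 4 + e / 4"
      using i e'(2) mult_left_mono[OF r(4)[of n], of "2 * K"] K by linarith
    finally show ?thesis using n0[OF n] e unfolding real_norm_def diff_0_right by linarith
  qed
  then show "\<exists>n0. \<forall>n\<ge>n0. norm ((\<integral>x. w n x * h x \<partial>N) - 0) < e" by blast
qed

lemma AE_lborel_interval_witness:
  fixes a b :: real
  assumes "AE t in lborel. t \<in> {a<..<b} \<longrightarrow> P t" "a < b"
  obtains t where "a < t" "t < b" "P t"
proof (rule ccontr)
  assume "\<not> thesis"
  with that have "\<And>t. t \<in> {a<..<b} \<Longrightarrow> \<not> P t" by auto
  with assms(1) have "AE t in lborel. t \<notin> {a<..<b}" by auto
  then have "{a<..<b} \<in> null_sets lborel" by (subst AE_iff_null_sets) auto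
  then show False using assms(2) by (auto simp: null_sets_def)
qed

text \<open>The test functions for which convergence holds are enlarged step by step by means of the previous
  closure property: indicators of half-lines, indicators of Borel sets (Dynkin's theorem), simple
  functions, bounded Borel functions.\<close>

lemma unif_integrable_weak_null:
  fixes w :: "nat \<Rightarrow> real \<Rightarrow> real"
  assumes T: "0 < T" and w: "\<And>n. integrable lborel (w n)"
    and supp: "\<And>n x. x \<notin> {0..T} \<Longrightarrow> w n x = 0"
    and ui: "\<And>e. 0 < e \<Longrightarrow> \<exists>k. integrable lborel k \<and>
      (\<forall>n. \<exists>r. integrable lborel r \<and> (\<forall>x. 0 \<le> r x) \<and> (\<forall>x. \<bar>w n x\<bar> \<le> k x + r x) \<and> (\<integral>x. r x \<partial>lborel) \<le> e)"
    and primitive: "AE t in lborel. t \<in> {0..T} \<longrightarrow> (\<lambda>n. \<integral>x. w n x * indicator {..t} x \<partial>lborel) \<longlonglongrightarrow> 0"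
    and g: "g \<in> borel_measurable borel" "\<And>x. \<bar>g x\<bar> \<le> K"
  shows "(\<lambda>n. \<integral>x. w n x * g x \<partial>lborel) \<longlonglongrightarrow> 0"
proof -
  let ?P = "\<lambda>B :: real set. (\<lambda>n. \<integral>x. w n x * indicator B x \<partial>lborel) \<longlonglongrightarrow> 0"
  note closure = unif_integrable_bounded_convergence[OF w ui]
  have wm[measurable]: "\<And>n. w n \<in> borel_measurable borel" using w by (auto dest: borel_measurable_integrable)
  have int_ind: "integrable lborel (\<lambda>x. w n x * indicator B x)" if "B \<in> sets borel" for n B
    using integrable_mult_indicator[OF _ w[of n], of B] that by (simp add: mult.commute)
  have atMost: "?P {..t}" for t
  proof (cases "t \<le> 0")
    case True
    have "(\<integral>x. w n x * indicator {..t} x \<partial>lborel) = (\<integral>x. 0 \<partial>(lborel :: real measure))" for n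
    proof (rule integral_cong_AE)
      show "AE x in lborel. w n x * indicator {..t} x = 0"
        using AE_lborel_singleton[of 0] by eventually_elim (use supp True in \<open>auto simp: indicator_def\<close>)
    qed auto
    then show ?thesis by simp
  next
    case False
    \<comment> \<open>The half-line is approximated from inside by half-lines whose endpoints in \<open>(0, s)\<close> are not exceptional.\<close>
    define s where "s = min t T"
    have s: "0 < s" "s \<le> T" using False T by (auto simp: s_def)
    have "\<exists>\<tau>. s - 1 / real (Suc j) < \<tau> \<and> \<tau> < s \<and> ?P {..\<tau>}" for j
    proof -
      have "AE \<tau> in lborel. \<tau> \<in> {max 0 (s - 1 / real (Suc j))<..<s} \<longrightarrow> ?P {..\<tau>}"
        using primitive by eventually_elim (use s in auto)
      then show ?thesis
      proof (rule AE_lborel_interval_witness)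
        fix \<tau> assume "max 0 (s - 1 / real (Suc j)) < \<tau>" "\<tau> < s" "?P {..\<tau>}"
        then show ?thesis by (intro exI[of _ \<tau>]) simp
      qed (use s in simp)
    qed
    then obtain \<tau> where \<tau>: "\<And>j. s - 1 / real (Suc j) < \<tau> j" "\<And>j. \<tau> j < s" "\<And>j. ?P {..\<tau> j}" by metis
    have "(\<lambda>j. 1 / real (Suc j)) \<longlonglongrightarrow> 0" using LIMSEQ_inverse_real_of_nat by (simp add: inverse_eq_divide)
    from tendsto_diff[OF tendsto_const[of s] this] have "(\<lambda>j. s - 1 / real (Suc j)) \<longlonglongrightarrow> s" by simp
    then have lim: "\<tau> \<longlonglongrightarrow> s"
      by (rule real_tendsto_sandwich[rotated 2, OF _ tendsto_const])
        (auto intro!: always_eventually less_imp_le \<tau> simp del: of_nat_Suc)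
    have "?P {..<s}"
    proof (rule closure[where K=1 and g="\<lambda>j. indicator {..\<tau> j}"])
      fix x
      show "(\<lambda>j. indicator {..\<tau> j} x :: real) \<longlonglongrightarrow> indicator {..<s} x"
      proof (cases "x < s")
        case True
        then have "\<forall>\<^sub>F j in sequentially. x < \<tau> j" using order_tendstoD(1)[OF lim] by blast
        then have "\<forall>\<^sub>F j in sequentially. indicator {..\<tau> j} x = (indicator {..<s} x :: real)"
          by eventually_elim (use True in auto)
        then show ?thesis by (rule tendsto_eventually)
      next
        case False
        then have "indicator {..\<tau> j} x = (indicator {..<s} x :: real)" for j using \<tau>(2)[of j] by (auto simp: indicator_def)
        then show ?thesis by simp
      qed
    qed (use \<tau>(3) in \<open>auto simp: indicator_def\<close>)
    moreover have "(\<integral>x. w n x * indicator {..t} x \<partial>lborel) = (\<integral>x. w n x * indicator {..<s} x \<partial>lborel)" for n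
    proof (rule integral_cong_AE)
      show "AE x in lborel. w n x * indicator {..t} x = w n x * indicator {..<s} x"
        using AE_lborel_singleton[of s]
      proof eventually_elim
        case (elim x)
        then show ?case using supp[of x n] by (cases "x \<in> {0..T}") (auto simp: indicator_def s_def)
      qed
    qed auto
    ultimately show ?thesis by simp
  qed
  have UNIV: "(\<lambda>n. \<integral>x. w n x \<partial>lborel) \<longlonglongrightarrow> 0"
  proof -
    have "(\<lambda>x. w n x * indicator {..T} x) = w n" for n
      using supp[of _ n] by (auto simp: indicator_def fun_eq_iff)
    then show ?thesis using atMost[of T] by simp
  qed
  have sets: "?P B" if "B \<in> sets borel" for B
  proof -
    let ?G = "range (\<lambda>t :: real. {..t})"
    have sb: "sets borel = sigma_sets UNIV ?G" unfolding borel_eq_atMost by (rule sets_measure_of) auto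
    have "Int_stable ?G"
    proof (rule Int_stableI)
      fix a b assume "a \<in> ?G" "b \<in> ?G"
      then obtain s t where "a = {..s}" "b = {..t}" by auto
      then have "a \<inter> b = {..min s t}" by auto
      then show "a \<inter> b \<in> ?G" by blast
    qed
    then show ?thesis
    proof (rule sigma_sets_induct_disjoint[OF _ _ that[unfolded sb]])
      fix B assume "B \<in> sigma_sets UNIV ?G" and B: "?P B"
      then have [measurable]: "B \<in> sets borel" by (simp only: sb)
      have "(\<integral>x. w n x * indicator (UNIV - B) x \<partial>lborel)
          = (\<integral>x. w n x \<partial>lborel) - (\<integral>x. w n x * indicator B x \<partial>lborel)" for n
        by (subst Bochner_Integration.integral_diff[OF w int_ind, symmetric])
          (auto simp: indicator_def intro!: Bochner_Integration.integral_cong)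
      then show "?P (UNIV - B)" using tendsto_diff[OF UNIV B] by simp
    next
      fix B :: "nat \<Rightarrow> real set"
      assume disj: "disjoint_family B" and "range B \<subseteq> sigma_sets UNIV ?G" and B: "\<And>i. ?P (B i)"
      then have [measurable]: "\<And>i. B i \<in> sets borel" by (auto simp only: sb)
      show "?P (\<Union>i. B i)"
      proof (rule closure[where K=1 and g="\<lambda>j. indicator (\<Union>i<j. B i)"])
        fix j
        have "w n x * indicator (\<Union>i<j. B i) x = (\<Sum>i<j. w n x * indicator (B i) x)" for n x
          by (subst indicator_UN_disjoint) (use disj in \<open>auto simp: sum_distrib_left disjoint_family_on_def\<close>)
        then have "(\<integral>x. w n x * indicator (\<Union>i<j. B i) x \<partial>lborel)
            = (\<integral>x. (\<Sum>i<j. w n x * indicator (B i) x) \<partial>lborel)" for n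
          by (intro Bochner_Integration.integral_cong) auto
        also have "\<dots> n = (\<Sum>i<j. \<integral>x. w n x * indicator (B i) x \<partial>lborel)" for n
          by (rule Bochner_Integration.integral_sum) (use int_ind in simp)
        finally have "(\<integral>x. w n x * indicator (\<Union>i<j. B i) x \<partial>lborel)
            = (\<Sum>i<j. \<integral>x. w n x * indicator (B i) x \<partial>lborel)" for n .
        then show "(\<lambda>n. \<integral>x. w n x * indicator (\<Union>i<j. B i) x \<partial>lborel) \<longlonglongrightarrow> 0"
          by (simp only:) (intro tendsto_null_sum B)
        show "\<bar>indicator (\<Union>i<j. B i) x\<bar> \<le> (1 :: real)" for x by (simp add: indicator_def)
        show "(\<lambda>j. indicator (\<Union>i<j. B i) x :: real) \<longlonglongrightarrow> indicator (\<Union>i. B i) x" for x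
          by (rule LIMSEQ_indicator_UN)
      qed measurable
    qed (use atMost in auto)
  qed
  obtain q where q: "\<And>i. simple_function borel (q i)" "\<And>x. (\<lambda>i. q i x) \<longlonglongrightarrow> g x"
      "\<And>i x. \<bar>q i x\<bar> \<le> 2 * \<bar>g x\<bar>"
    using borel_measurable_implies_sequence_metric[OF g(1), of 0] by (auto simp: dist_real_def)
  show ?thesis
  proof (rule closure[where K="2 * K" and g=q])
    fix i
    have fin: "finite (range (q i))" using q(1)[of i] by (simp add: simple_function_def)
    have [measurable]: "q i \<in> borel_measurable borel" by (rule borel_measurable_simple_function[OF q(1)])
    show "q i \<in> borel_measurable lborel" by simp
    have vim: "q i -` {y} \<in> sets borel" for y using measurable_sets[of "q i" borel borel "{y}"] by simp
    have rep: "q i x = (\<Sum>y\<in>range (q i). y * indicator (q i -` {y}) x)" for x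
    proof -
      have "(\<Sum>y\<in>range (q i). y * indicator (q i -` {y}) x) = (\<Sum>y\<in>range (q i). if y = q i x then y else 0)"
        by (intro sum.cong) (auto simp: indicator_def)
      also have "\<dots> = q i x" using fin by (subst sum.delta) auto
      finally show ?thesis by (rule sym)
    qed
    have "w n x * q i x = (\<Sum>y\<in>range (q i). y * (w n x * indicator (q i -` {y}) x))" for n x
      by (subst rep) (simp only: sum_distrib_left mult.left_commute)
    then have "(\<integral>x. w n x * q i x \<partial>lborel)
        = (\<integral>x. (\<Sum>y\<in>range (q i). y * (w n x * indicator (q i -` {y}) x)) \<partial>lborel)" for n
      by (simp only:)
    also have "\<dots> n = (\<Sum>y\<in>range (q i). y * (\<integral>x. w n x * indicator (q i -` {y}) x \<partial>lborel))" for n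
      using int_ind[OF vim] by simp
    finally show "(\<lambda>n. \<integral>x. w n x * q i x \<partial>lborel) \<longlonglongrightarrow> 0"
      by (simp only:) (intro tendsto_null_sum tendsto_mult_right_zero sets vim)
    show "\<bar>q i x\<bar> \<le> 2 * K" for x using q(3)[of i x] g(2)[of x] by linarith
  qed (use q g in auto)
qed

section \<open>Young functions\<close>

text \<open>A non-decreasing density is bounded on bounded intervals, hence integrable there; this makes the Bochner
  integral that defines \<open>\<Psi>\<close> additive over adjacent intervals.\<close>

lemma young_functionE:
  assumes "young_function \<Psi>"
  obtains \<psi> where "\<And>s. 0 \<le> s \<Longrightarrow> 0 \<le> \<psi> s" "mono_on {0..} \<psi>" "filterlim \<psi> at_top at_top"
    "\<And>t. 0 \<le> t \<Longrightarrow> \<Psi> t = (LINT s:{0..t}|lborel. \<psi> s)"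
    "\<And>c d. 0 \<le> c \<Longrightarrow> set_integrable lborel {c..d} \<psi>"
proof -
  from assms obtain \<psi> :: "real \<Rightarrow> real" where \<psi>: "\<psi> 0 = 0" "\<forall>s>0. 0 < \<psi> s" "mono_on {0..} \<psi>"
    "filterlim \<psi> at_top at_top" "\<forall>t\<ge>0. \<Psi> t = (LINT s:{0..t}|lborel. \<psi> s)"
    unfolding young_function_def by blast
  have nonneg: "0 \<le> \<psi> s" if "0 \<le> s" for s using \<psi>(1,2) that by (cases "s = 0") (auto intro: less_imp_le)
  have int: "set_integrable lborel {c..d} \<psi>" if c: "0 \<le> c" for c d
    unfolding set_integrable_def
  proof (rule Bochner_Integration.integrable_bound)
    show "integrable lborel (\<lambda>x. \<psi> (max 0 d) * indicator {c..d} x)"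
      by (intro integrable_mult_right integrable_real_indicator) (auto simp: emeasure_lborel_Icc_eq)
    have "(\<lambda>x. indicator {c..d} x *\<^sub>R \<psi> x) = (\<lambda>x. indicator {c..d} x *\<^sub>R (if x \<in> {0..} then \<psi> x else 0))"
      using c by (auto simp: indicator_def)
    moreover have "(\<lambda>x. if x \<in> {0..} then \<psi> x else 0) \<in> borel_measurable borel"
      using borel_measurable_mono_on_fnc[OF \<psi>(3)] by (subst (asm) measurable_restrict_space_iff[where c=0]) auto
    ultimately show "(\<lambda>x. indicator {c..d} x *\<^sub>R \<psi> x) \<in> borel_measurable lborel" by simp
    show "AE x in lborel. norm (indicator {c..d} x *\<^sub>R \<psi> x) \<le> norm (\<psi> (max 0 d) * indicator {c..d} x)"
    proof (intro AE_I2)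
      fix x show "norm (indicator {c..d} x *\<^sub>R \<psi> x) \<le> norm (\<psi> (max 0 d) * indicator {c..d} x)"
        using mono_onD[OF \<psi>(3), of x "max 0 d"] nonneg[of x] nonneg[of "max 0 d"] c by (auto simp: indicator_def)
    qed
  qed
  show thesis by (rule that[of \<psi>]) (use nonneg int \<psi> in auto)
qed

lemma set_integral_atLeastAtMost_split:
  fixes f :: "real \<Rightarrow> real"
  assumes "a \<le> b" "b \<le> c" "set_integrable lborel {a..c} f"
  shows "(LINT s:{a..c}|lborel. f s) = (LINT s:{a..b}|lborel. f s) + (LINT s:{b..c}|lborel. f s)"
proof -
  have sub: "set_integrable lborel {a..b} f" "set_integrable lborel {b..c} f"
    by (rule set_integrable_subset[OF assms(3)]; use assms in auto)+
  have "(LINT s:{a..c}|lborel. f s)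
      = (\<integral>s. indicator {a..b} s *\<^sub>R f s + indicator {b..c} s *\<^sub>R f s \<partial>lborel)"
    unfolding set_lebesgue_integral_def
  proof (rule integral_cong_AE)
    show "AE s in lborel. indicator {a..c} s *\<^sub>R f s = indicator {a..b} s *\<^sub>R f s + indicator {b..c} s *\<^sub>R f s"
      using AE_lborel_singleton[of b] by eventually_elim (use assms in \<open>auto simp: indicator_def\<close>)
  qed (use sub assms(3) in \<open>auto simp: set_integrable_def\<close>)
  also have "\<dots> = (LINT s:{a..b}|lborel. f s) + (LINT s:{b..c}|lborel. f s)"
    using sub unfolding set_lebesgue_integral_def set_integrable_def by simp
  finally show ?thesis .
qed

lemma young_function_nonneg:
  assumes "young_function \<Psi>" "0 \<le> t" shows "0 \<le> \<Psi> t"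
  using assms(1)
proof (rule young_functionE)
  fix \<psi> assume "\<And>s. 0 \<le> s \<Longrightarrow> 0 \<le> \<psi> s" "\<And>t. 0 \<le> t \<Longrightarrow> \<Psi> t = (LINT s:{0..t}|lborel. \<psi> s)"
  with assms(2) show ?thesis by (auto simp: set_lebesgue_integral_def indicator_def intro!: integral_nonneg_AE AE_I2)
qed

lemma young_function_mono:
  assumes "young_function \<Psi>" "0 \<le> s" "s \<le> t" shows "\<Psi> s \<le> \<Psi> t"
  using assms(1)
proof (rule young_functionE)
  fix \<psi> assume \<psi>: "\<And>s. 0 \<le> s \<Longrightarrow> 0 \<le> \<psi> s" "\<And>t. 0 \<le> t \<Longrightarrow> \<Psi> t = (LINT s:{0..t}|lborel. \<psi> s)"
    "\<And>c d. 0 \<le> c \<Longrightarrow> set_integrable lborel {c..d} \<psi>"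
  have "0 \<le> (LINT x:{s..t}|lborel. \<psi> x)"
    unfolding set_lebesgue_integral_def using \<psi>(1) assms by (auto intro!: integral_nonneg_AE AE_I2 simp: indicator_def)
  then show ?thesis
    using set_integral_atLeastAtMost_split[of 0 s t \<psi>] \<psi>(2)[of s] \<psi>(2)[of t] \<psi>(3)[of 0 t] assms by simp
qed

lemma young_function_measurable:
  assumes "young_function \<Psi>" and [measurable]: "u \<in> borel_measurable N"
  shows "(\<lambda>x. \<Psi> \<bar>u x\<bar>) \<in> borel_measurable N"
proof -
  have "mono_on {0..} \<Psi>" using young_function_mono[OF assms(1)] by (auto simp: mono_on_def)
  from borel_measurable_mono_on_fnc[OF this]
  have [measurable]: "(\<lambda>x. if x \<in> {0..} then \<Psi> x else 0) \<in> borel_measurable borel"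
    by (subst (asm) measurable_restrict_space_iff[where c=0]) auto
  have "(\<lambda>x. (\<lambda>x. if x \<in> {0..} then \<Psi> x else 0) \<bar>u x\<bar>) \<in> borel_measurable N" by measurable
  then show ?thesis by simp
qed

text \<open>Beyond the point where the density exceeds \<open>1 / \<epsilon>\<close>, the function grows at least at that rate. This is the
  source of uniform integrability for controls with bounded penalty.\<close>

lemma young_function_superlinear:
  assumes "young_function \<Psi>" "0 < \<epsilon>"
  obtains K where "0 \<le> K" "\<And>x. 0 \<le> x \<Longrightarrow> x \<le> K + \<epsilon> * \<Psi> x"
  using assms(1)
proof (rule young_functionE)
  fix \<psi> assume \<psi>: "\<And>s. 0 \<le> s \<Longrightarrow> 0 \<le> \<psi> s" "filterlim \<psi> at_top at_top"
    "\<And>t. 0 \<le> t \<Longrightarrow> \<Psi> t = (LINT s:{0..t}|lborel. \<psi> s)"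
    "\<And>c d. 0 \<le> c \<Longrightarrow> set_integrable lborel {c..d} \<psi>"
  from \<psi>(2) obtain N where N: "\<And>s. s \<ge> N \<Longrightarrow> 1 / \<epsilon> \<le> \<psi> s"
    by (auto simp: filterlim_at_top eventually_at_top_linorder)
  define K where "K = max 0 N"
  show thesis
  proof (rule that[of K])
    fix x :: real assume x: "0 \<le> x"
    show "x \<le> K + \<epsilon> * \<Psi> x"
    proof (cases "x \<le> K")
      case True
      have "0 \<le> \<epsilon> * \<Psi> x" using young_function_nonneg[OF assms(1) x] assms(2) by simp
      then show ?thesis using True by simp
    next
      case False
      have K: "0 \<le> K" "N \<le> K" by (auto simp: K_def)
      have "(x - K) / \<epsilon> = (LINT s:{K..x}|lborel. 1 / \<epsilon>)"
        using False by (simp add: set_lebesgue_integral_def)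
      also have "\<dots> \<le> (LINT s:{K..x}|lborel. \<psi> s)"
      proof (rule set_integral_mono)
        show "set_integrable lborel {K..x} (\<lambda>s. 1 / \<epsilon>)"
          unfolding set_integrable_def real_scaleR_def
          by (intro integrable_mult_left integrable_real_indicator) (auto simp: emeasure_lborel_Icc_eq)
        show "set_integrable lborel {K..x} \<psi>" by (rule \<psi>(4)) fact
        show "1 / \<epsilon> \<le> \<psi> s" if "s \<in> {K..x}" for s using that K(2) by (intro N) simp
      qed
      also have "\<dots> \<le> \<Psi> x"
        using set_integral_atLeastAtMost_split[of 0 K x \<psi>] \<psi>(3)[of x] \<psi>(3)[of K] \<psi>(4)[of 0 x] K False x
          young_function_nonneg[OF assms(1) K(1)] by simp
      finally show ?thesis using assms(2) by (simp add: field_simps)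
    qed
  qed (simp add: K_def)
qed

text \<open>Iterating the doubling condition until \<open>2 ^ m\<close> exceeds the scaling parameter \<open>l\<close> removes the scaling.\<close>

lemma Delta2_FPsi_finite:
  assumes \<Psi>: "young_function \<Psi>" "Delta2 \<Psi>" and u: "u \<in> LPsi T \<Psi>"
  shows "FPsi T \<Psi> u < \<infinity>"
proof -
  obtain l where l: "0 < l" "(\<integral>\<^sup>+t\<in>{0..T}. ennreal (\<Psi> (\<bar>u t\<bar> / l)) \<partial>lborel) < \<infinity>" and "u \<in> L1 T"
    using u by (auto simp: LPsi_def)
  obtain k where k: "0 < k" "\<And>t. 0 \<le> t \<Longrightarrow> \<Psi> (2 * t) \<le> k * \<Psi> t" using \<Psi>(2) by (auto simp: Delta2_def)
  have pow: "\<Psi> (2 ^ m * t) \<le> k ^ m * \<Psi> t" if "0 \<le> t" for m t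
  proof (induction m)
    case (Suc m)
    have "\<Psi> (2 ^ Suc m * t) \<le> k * \<Psi> (2 ^ m * t)" using k(2)[of "2 ^ m * t"] that by (simp add: ac_simps)
    also have "\<dots> \<le> k * (k ^ m * \<Psi> t)" using Suc k(1) by simp
    finally show ?case by (simp add: ac_simps)
  qed simp
  obtain m where m: "l < 2 ^ m" using real_arch_pow[of 2 l] by auto
  have le: "\<Psi> \<bar>u t\<bar> \<le> k ^ m * \<Psi> (\<bar>u t\<bar> / l)" for t
  proof -
    have "\<bar>u t\<bar> = l * (\<bar>u t\<bar> / l)" using l by simp
    also have "\<dots> \<le> 2 ^ m * (\<bar>u t\<bar> / l)" using m l by (intro mult_right_mono) auto
    finally have "\<Psi> \<bar>u t\<bar> \<le> \<Psi> (2 ^ m * (\<bar>u t\<bar> / l))" by (intro young_function_mono[OF \<Psi>(1)]) auto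
    also have "\<dots> \<le> k ^ m * \<Psi> (\<bar>u t\<bar> / l)" using l by (intro pow) simp
    finally show ?thesis .
  qed
  have [measurable]: "(\<lambda>t. indicator {0..T} t * u t) \<in> borel_measurable borel"
    using \<open>u \<in> L1 T\<close> by (auto simp: L1_def set_integrable_def dest: borel_measurable_integrable)
  have "(\<lambda>t. \<Psi> \<bar>(indicator {0..T} t * u t) / l\<bar>) \<in> borel_measurable lborel"
    by (rule young_function_measurable[OF \<Psi>(1)]) measurable
  then have meas: "(\<lambda>t. ennreal (\<Psi> \<bar>(indicator {0..T} t * u t) / l\<bar>) * indicator {0..T} t) \<in> borel_measurable lborel"
    by measurable
  have "FPsi T \<Psi> u \<le> (\<integral>\<^sup>+t. ennreal (k ^ m) * (ennreal (\<Psi> \<bar>(indicator {0..T} t * u t) / l\<bar>) * indicator {0..T} t) \<partial>lborel)"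
    unfolding FPsi_def using le k(1) l(1)
    by (intro nn_integral_mono) (auto simp: indicator_def ennreal_mult'[symmetric] intro!: ennreal_leI)
  also have "\<dots> = ennreal (k ^ m) * (\<integral>\<^sup>+t. ennreal (\<Psi> \<bar>(indicator {0..T} t * u t) / l\<bar>) * indicator {0..T} t \<partial>lborel)"
    by (rule nn_integral_cmult) (rule meas)
  also have "(\<integral>\<^sup>+t. ennreal (\<Psi> \<bar>(indicator {0..T} t * u t) / l\<bar>) * indicator {0..T} t \<partial>lborel)
      = (\<integral>\<^sup>+t\<in>{0..T}. ennreal (\<Psi> (\<bar>u t\<bar> / l)) \<partial>lborel)"
    using l(1) by (intro nn_integral_cong) (auto simp: indicator_def)
  finally show ?thesis using l(2) by (simp add: ennreal_mult_less_top order_le_less_trans)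
qed

section \<open>The state equation\<close>

text \<open>The reciprocal of the fundamental solution \<open>G t * exp (A t)\<close> of the homogeneous equation; dividing the state
  by that solution turns the state equation into a pure integration.\<close>

definition integrating_factor :: "(real \<Rightarrow> real) \<Rightarrow> (real \<Rightarrow> 'a \<Rightarrow> real) \<Rightarrow> real \<Rightarrow> 'a \<Rightarrow> real" where
  "integrating_factor a W s \<omega> = exp (- A a s) / G W s \<omega>"

lemma integrating_factor_pos: "0 < integrating_factor a W s \<omega>"
  by (simp add: integrating_factor_def G_def)

lemma xi_eq_integrating_factor:
  "\<xi> a W z u t \<omega> = (LINT s:{0..t}|lborel. integrating_factor a W s \<omega> * (z s \<omega> - u s)) / integrating_factor a W t \<omega>"
  by (simp add: \<xi>_def integrating_factor_def exp_minus field_simps)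

lemma A_bounded:
  assumes a: "set_integrable lborel {0..T} a" and t: "t \<in> {0..T}"
  shows "\<bar>A a t\<bar> \<le> (LINT s:{0..T}|lborel. \<bar>a s\<bar>)"
proof -
  have "\<bar>A a t\<bar> \<le> (\<integral>s. \<bar>indicator {0..t} s *\<^sub>R a s\<bar> \<partial>lborel)"
    unfolding A_def set_lebesgue_integral_def by (rule integral_abs_bound)
  also have "\<dots> \<le> (\<integral>s. indicator {0..T} s *\<^sub>R \<bar>a s\<bar> \<partial>lborel)"
  proof (rule integral_mono)
    have "set_integrable lborel {0..t} a" by (rule set_integrable_subset[OF a]) (use t in auto)
    then show "integrable lborel (\<lambda>s. \<bar>indicator {0..t} s *\<^sub>R a s\<bar>)" unfolding set_integrable_def by (rule integrable_abs)
    show "integrable lborel (\<lambda>s. indicator {0..T} s *\<^sub>R \<bar>a s\<bar>)"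
      using set_integrable_abs[OF a] by (simp add: set_integrable_def)
    show "\<bar>indicator {0..t} s *\<^sub>R a s\<bar> \<le> indicator {0..T} s *\<^sub>R \<bar>a s\<bar>" for s
      using t by (auto simp: indicator_def)
  qed
  finally show ?thesis by (simp add: set_lebesgue_integral_def)
qed

lemma L1_measurable: "u \<in> L1 T \<Longrightarrow> (\<lambda>s. indicator {0..T} s * u s) \<in> borel_measurable borel"
  by (auto simp: L1_def set_integrable_def dest: borel_measurable_integrable)

lemma L1_midpoint: "u \<in> L1 T \<Longrightarrow> v \<in> L1 T \<Longrightarrow> (\<lambda>s. (u s + v s) / 2) \<in> L1 T"
  by (simp add: L1_def)

text \<open>Here every path of \<open>W\<close> is continuous and \<open>W\<close> is jointly measurable, whereas a Brownian motion has
  continuous paths only almost surely; the results apply to a modification of it on a null set. The other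
  data matter on \<open>{0..T}\<close> only, hence the indicators in the measurability assumptions.\<close>

locale regular_cost = prob_space M
  for M :: "'a measure" +
  fixes T :: real and a :: "real \<Rightarrow> real" and W z :: "real \<Rightarrow> 'a \<Rightarrow> real" and F :: "real \<Rightarrow> real \<Rightarrow> real"
  assumes T_pos: "0 < T"
    and a_int: "set_integrable lborel {0..T} a"
    and W_meas[measurable]: "(\<lambda>(t, \<omega>). W t \<omega>) \<in> borel_measurable (borel \<Otimes>\<^sub>M M)"
    and W_cont: "\<And>\<omega>. \<omega> \<in> space M \<Longrightarrow> continuous_on {0..T} (\<lambda>t. W t \<omega>)"
    and z_meas[measurable]: "(\<lambda>(t, \<omega>). indicator {0..T} t * z t \<omega>) \<in> borel_measurable (borel \<Otimes>\<^sub>M M)"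
    and F_meas[measurable]: "(\<lambda>(t, x). indicator {0..T} t * F t x) \<in> borel_measurable (borel \<Otimes>\<^sub>M borel)"
    and F_nonneg: "\<And>t x. t \<in> {0..T} \<Longrightarrow> 0 \<le> F t x"
begin

abbreviation h :: "real \<Rightarrow> 'a \<Rightarrow> real" where "h \<equiv> integrating_factor a W"

lemma A_measurable[measurable]: "(\<lambda>s. indicator {0..T} s * A a s) \<in> borel_measurable borel"
proof -
  have [measurable]: "(\<lambda>r. indicator {0..T} r * a r) \<in> borel_measurable borel"
    using a_int by (auto simp: set_integrable_def dest: borel_measurable_integrable)
  have eq: "indicator {0..T} s * A a s = indicator {0..T} s *
      (\<integral>r. (if 0 \<le> r \<and> r \<le> s then indicator {0..T} r * a r else 0) \<partial>lborel)" for s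
    unfolding A_def set_lebesgue_integral_def
    by (cases "s \<in> {0..T}") (auto intro!: Bochner_Integration.integral_cong simp: indicator_def)
  show ?thesis unfolding eq by measurable
qed

lemma h_measurable[measurable]: "(\<lambda>(s, \<omega>). indicator {0..T} s * h s \<omega>) \<in> borel_measurable (borel \<Otimes>\<^sub>M M)"
proof -
  have "indicator {0..T} s * h s \<omega> = indicator {0..T} s * (exp (- (indicator {0..T} s * A a s)) / exp (W s \<omega> - s / 2))" for s \<omega>
    by (cases "s \<in> {0..T}") (auto simp: integrating_factor_def G_def)
  then show ?thesis by simp
qed

lemma h_path_measurable: "\<omega> \<in> space M \<Longrightarrow> (\<lambda>s. indicator {0..T} s * h s \<omega>) \<in> borel_measurable borel"
  by measurable

lemma h_bounds:
  assumes w: "\<omega> \<in> space M"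
  obtains c H where "0 < c" "0 < H" "\<And>s. s \<in> {0..T} \<Longrightarrow> c \<le> h s \<omega>" "\<And>s. s \<in> {0..T} \<Longrightarrow> h s \<omega> \<le> H"
proof -
  have "bounded ((\<lambda>t. W t \<omega>) ` {0..T})"
    by (intro compact_imp_bounded compact_continuous_image W_cont w) simp
  then obtain B where B: "\<And>s. s \<in> {0..T} \<Longrightarrow> \<bar>W s \<omega>\<bar> \<le> B"
    unfolding bounded_iff real_norm_def by blast
  define D where "D = (LINT s:{0..T}|lborel. \<bar>a s\<bar>)"
  note D = A_bounded[OF a_int, folded D_def]
  have eq: "h s \<omega> = exp (- A a s - W s \<omega> + s / 2)" for s
    by (simp add: integrating_factor_def G_def exp_diff[symmetric])
  show thesis
  proof (rule that[of "exp (- D - B)" "exp (D + B + T / 2)"])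
    fix s assume s: "s \<in> {0..T}"
    show "exp (- D - B) \<le> h s \<omega>" "h s \<omega> \<le> exp (D + B + T / 2)"
      unfolding eq exp_le_cancel_iff using B[OF s] D[OF s] s unfolding abs_le_iff atLeastAtMost_iff by linarith+
  qed auto
qed

text \<open>The truncation to \<open>{0..T}\<close> is what makes the statement meaningful on the whole line: outside the
  interval neither the coefficients nor the control are constrained.\<close>

lemma xi_measurable:
  assumes u: "u \<in> L1 T"
  shows "(\<lambda>(t, \<omega>). indicator {0..T} t * \<xi> a W z u t \<omega>) \<in> borel_measurable (borel \<Otimes>\<^sub>M M)"
proof -
  note [measurable] = L1_measurable[OF u]
  have eq: "indicator {0..T} t * \<xi> a W z u t \<omega> = indicator {0..T} t *
     ((\<integral>s. (if 0 \<le> s \<and> s \<le> t then (indicator {0..T} s * h s \<omega>) * (indicator {0..T} s * z s \<omega> - indicator {0..T} s * u s) else 0) \<partial>lborel)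
      / (indicator {0..T} t * h t \<omega>))" for t \<omega>
    unfolding xi_eq_integrating_factor set_lebesgue_integral_def
    by (cases "t \<in> {0..T}") (auto intro!: arg_cong2[where f="(/)"] Bochner_Integration.integral_cong simp: indicator_def)
  show ?thesis unfolding eq by measurable
qed

lemma h_mult_integrable:
  assumes w: "\<omega> \<in> space M" and f: "set_integrable lborel {0..T} f" and t: "t \<le> T"
  shows "set_integrable lborel {0..t} (\<lambda>s. h s \<omega> * f s)"
proof -
  obtain c H where H: "0 < c" "0 < H" "\<And>s. s \<in> {0..T} \<Longrightarrow> c \<le> h s \<omega>" "\<And>s. s \<in> {0..T} \<Longrightarrow> h s \<omega> \<le> H"
    using h_bounds[OF w] by blast
  note [measurable] = h_path_measurable[OF w]
  have [measurable]: "(\<lambda>s. indicator {0..T} s * f s) \<in> borel_measurable borel"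
    using f by (auto simp: set_integrable_def dest: borel_measurable_integrable)
  have "set_integrable lborel {0..T} (\<lambda>s. h s \<omega> * f s)" unfolding set_integrable_def
  proof (rule Bochner_Integration.integrable_bound)
    show "integrable lborel (\<lambda>s. H * (indicator {0..T} s *\<^sub>R f s))"
      using f unfolding set_integrable_def by simp
    have "(\<lambda>s. (indicator {0..T} s * h s \<omega>) * (indicator {0..T} s * f s)) \<in> borel_measurable lborel"
      by measurable
    moreover have "indicator {0..T} s *\<^sub>R (h s \<omega> * f s) = (indicator {0..T} s * h s \<omega>) * (indicator {0..T} s * f s)" for s
      by (auto simp: indicator_def)
    ultimately show "(\<lambda>s. indicator {0..T} s *\<^sub>R (h s \<omega> * f s)) \<in> borel_measurable lborel" by (simp only:)
    show "AE s in lborel. norm (indicator {0..T} s *\<^sub>R (h s \<omega> * f s)) \<le> norm (H * (indicator {0..T} s *\<^sub>R f s))"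
    proof (intro AE_I2)
      fix s show "norm (indicator {0..T} s *\<^sub>R (h s \<omega> * f s)) \<le> norm (H * (indicator {0..T} s *\<^sub>R f s))"
        using H(4)[of s] H(2) integrating_factor_pos[of a W s \<omega>]
        by (auto simp: indicator_def abs_mult intro!: mult_right_mono)
    qed
  qed
  then show ?thesis by (rule set_integrable_subset) (use t in auto)
qed

lemma xi_diff:
  assumes w: "\<omega> \<in> space M" and z: "set_integrable lborel {0..T} (\<lambda>s. z s \<omega>)"
    and uv: "u \<in> L1 T" "v \<in> L1 T" and t: "t \<in> {0..T}"
  shows "h t \<omega> * (\<xi> a W z v t \<omega> - \<xi> a W z u t \<omega>) = (LINT s:{0..t}|lborel. h s \<omega> * (u s - v s))"
proof -
  have int: "set_integrable lborel {0..t} (\<lambda>s. h s \<omega> * (z s \<omega> - u s))" if "u \<in> L1 T" for u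
    using that z t by (intro h_mult_integrable[OF w]) (auto simp: L1_def)
  have "(LINT s:{0..t}|lborel. h s \<omega> * (u s - v s))
      = (LINT s:{0..t}|lborel. h s \<omega> * (z s \<omega> - v s) - h s \<omega> * (z s \<omega> - u s))"
    by (intro set_lebesgue_integral_cong) (auto simp: algebra_simps)
  also have "\<dots> = (LINT s:{0..t}|lborel. h s \<omega> * (z s \<omega> - v s)) - (LINT s:{0..t}|lborel. h s \<omega> * (z s \<omega> - u s))"
    by (intro set_integral_diff int uv)
  also have "\<dots> = h t \<omega> * (\<xi> a W z v t \<omega> - \<xi> a W z u t \<omega>)"
    using integrating_factor_pos[of a W t \<omega>] by (simp add: xi_eq_integrating_factor right_diff_distrib)
  finally show ?thesis by simp
qed

lemma xi_midpoint:
  assumes w: "\<omega> \<in> space M" and z: "set_integrable lborel {0..T} (\<lambda>s. z s \<omega>)"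
    and uv: "u \<in> L1 T" "v \<in> L1 T" and t: "t \<in> {0..T}"
  shows "\<xi> a W z (\<lambda>s. (u s + v s) / 2) t \<omega> = (\<xi> a W z u t \<omega> + \<xi> a W z v t \<omega>) / 2"
proof -
  let ?m = "\<lambda>s. (u s + v s) / 2"
  have "h t \<omega> * (\<xi> a W z v t \<omega> - \<xi> a W z ?m t \<omega>) = (LINT s:{0..t}|lborel. h s \<omega> * (?m s - v s))"
    by (rule xi_diff[OF w z L1_midpoint[OF uv] uv(2) t])
  also have "\<dots> = (LINT s:{0..t}|lborel. (1 / 2) * (h s \<omega> * (u s - v s)))"
    by (intro set_lebesgue_integral_cong) (auto simp: field_simps)
  also have "\<dots> = (1 / 2) * (h t \<omega> * (\<xi> a W z v t \<omega> - \<xi> a W z u t \<omega>))"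
    by (simp only: set_integral_mult_right xi_diff[OF w z uv t])
  finally have "h t \<omega> * (\<xi> a W z v t \<omega> - \<xi> a W z ?m t \<omega>) = h t \<omega> * ((\<xi> a W z v t \<omega> - \<xi> a W z u t \<omega>) / 2)" by simp
  then have "\<xi> a W z v t \<omega> - \<xi> a W z ?m t \<omega> = (\<xi> a W z v t \<omega> - \<xi> a W z u t \<omega>) / 2"
    using integrating_factor_pos[of a W t \<omega>] by (simp only: mult_cancel_left) auto
  then show ?thesis by (simp add: field_simps)
qed

section \<open>Convexity of the cost and convergence of the states\<close>

lemma cost_measurable:
  assumes "u \<in> L1 T"
  shows "(\<lambda>(t, \<omega>). indicator {0..T} t * F t (\<xi> a W z u t \<omega>)) \<in> borel_measurable (borel \<Otimes>\<^sub>M M)"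
proof -
  note [measurable] = xi_measurable[OF assms]
  have eq: "indicator {0..T} t * F t (\<xi> a W z u t \<omega>)
      = (\<lambda>(t, x). indicator {0..T} t * F t x) (t, indicator {0..T} t * \<xi> a W z u t \<omega>)" for t \<omega>
    by (auto simp: indicator_def)
  show ?thesis unfolding eq by measurable
qed

lemma J_indicator_form: "J M T a W z F u = (\<integral>\<^sup>+\<omega>. (\<integral>\<^sup>+t. ennreal (indicator {0..T} t * F t (\<xi> a W z u t \<omega>)) \<partial>lborel) \<partial>M)"
  unfolding J_def by (intro nn_integral_cong) (auto simp: indicator_def)

text \<open>Along almost every path this is the convexity defect of \<open>F t\<close> at the states of \<open>u\<close> and \<open>v\<close>, because the state of
  the midpoint control is the midpoint of the two states.\<close>

definition gap :: "(real \<Rightarrow> real) \<Rightarrow> (real \<Rightarrow> real) \<Rightarrow> real \<Rightarrow> 'a \<Rightarrow> real" where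
  "gap u v t \<omega> = indicator {0..T} t * ((F t (\<xi> a W z u t \<omega>) + F t (\<xi> a W z v t \<omega>)) / 2
     - F t (\<xi> a W z (\<lambda>s. (u s + v s) / 2) t \<omega>))"

lemma gap_measurable:
  assumes u: "u \<in> L1 T" and v: "v \<in> L1 T"
  shows "(\<lambda>(t, \<omega>). gap u v t \<omega>) \<in> borel_measurable (borel \<Otimes>\<^sub>M M)"
proof -
  note [measurable] = cost_measurable[OF u] cost_measurable[OF v] cost_measurable[OF L1_midpoint[OF u v]]
  have eq: "gap u v t \<omega> = (indicator {0..T} t * F t (\<xi> a W z u t \<omega>) + indicator {0..T} t * F t (\<xi> a W z v t \<omega>)) / 2
     - indicator {0..T} t * F t (\<xi> a W z (\<lambda>s. (u s + v s) / 2) t \<omega>)" for t \<omega>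
    by (auto simp: gap_def indicator_def)
  show ?thesis unfolding eq by measurable
qed

lemma gap_nonneg:
  assumes conv: "\<And>t. t \<in> {0..T} \<Longrightarrow> convex_on UNIV (F t)"
    and w: "\<omega> \<in> space M" and z: "set_integrable lborel {0..T} (\<lambda>s. z s \<omega>)"
    and uv: "u \<in> L1 T" "v \<in> L1 T"
  shows "0 \<le> gap u v t \<omega>"
proof (cases "t \<in> {0..T}")
  case True
  have "F t ((1 - 1/2) *\<^sub>R \<xi> a W z u t \<omega> + (1/2) *\<^sub>R \<xi> a W z v t \<omega>)
      \<le> (1 - 1/2) * F t (\<xi> a W z u t \<omega>) + 1/2 * F t (\<xi> a W z v t \<omega>)"
    by (rule convex_onD[OF conv[OF True]]) auto
  then show ?thesis
    unfolding gap_def xi_midpoint[OF w z uv True] using True by (simp add: add_divide_distrib)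
qed (simp add: gap_def)

text \<open>Integration of the definition of the defect. Sums in place of differences keep the identity valid when
  costs are infinite.\<close>

lemma J_midpoint_identity:
  assumes conv: "\<And>t. t \<in> {0..T} \<Longrightarrow> convex_on UNIV (F t)"
    and z: "AE \<omega> in M. set_integrable lborel {0..T} (\<lambda>s. z s \<omega>)"
    and uv: "u \<in> L1 T" "v \<in> L1 T"
  shows "J M T a W z F u + J M T a W z F v = 2 * J M T a W z F (\<lambda>s. (u s + v s) / 2)
    + 2 * (\<integral>\<^sup>+\<omega>. (\<integral>\<^sup>+t. ennreal (gap u v t \<omega>) \<partial>lborel) \<partial>M)"
proof -
  define m where "m = (\<lambda>s. (u s + v s) / 2)"
  note [measurable] = cost_measurable[OF uv(1)] cost_measurable[OF uv(2)]
    cost_measurable[OF L1_midpoint[OF uv], folded m_def] gap_measurable[OF uv]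
  let ?f = "\<lambda>u t \<omega>. indicator {0..T} t * F t (\<xi> a W z u t \<omega>)"
  have path: "(\<integral>\<^sup>+t. ennreal (?f u t \<omega>) \<partial>lborel) + (\<integral>\<^sup>+t. ennreal (?f v t \<omega>) \<partial>lborel)
      = 2 * (\<integral>\<^sup>+t. ennreal (?f m t \<omega>) \<partial>lborel) + 2 * (\<integral>\<^sup>+t. ennreal (gap u v t \<omega>) \<partial>lborel)"
    if w: "\<omega> \<in> space M" and z: "set_integrable lborel {0..T} (\<lambda>s. z s \<omega>)" for \<omega>
  proof -
    have nonneg: "0 \<le> ?f u t \<omega>" for u t using F_nonneg by (auto simp: indicator_def)
    have pt: "ennreal (?f u t \<omega>) + ennreal (?f v t \<omega>) = 2 * ennreal (?f m t \<omega>) + 2 * ennreal (gap u v t \<omega>)" for t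
    proof -
      have "?f u t \<omega> + ?f v t \<omega> = 2 * ?f m t \<omega> + 2 * gap u v t \<omega>"
        by (auto simp: gap_def m_def indicator_def)
      then have "ennreal (?f u t \<omega> + ?f v t \<omega>) = ennreal (2 * ?f m t \<omega> + 2 * gap u v t \<omega>)" by (simp only:)
      moreover have "ennreal (?f u t \<omega> + ?f v t \<omega>) = ennreal (?f u t \<omega>) + ennreal (?f v t \<omega>)"
        by (rule ennreal_plus[OF nonneg nonneg])
      moreover have "ennreal (2 * ?f m t \<omega> + 2 * gap u v t \<omega>) = 2 * ennreal (?f m t \<omega>) + 2 * ennreal (gap u v t \<omega>)"
        using nonneg gap_nonneg[OF conv w z uv, of t]
        by (subst ennreal_plus) (auto simp: ennreal_mult simp del: ennreal_plus)
      ultimately show ?thesis by (simp only:)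
    qed
    have "(\<integral>\<^sup>+t. ennreal (?f u t \<omega>) \<partial>lborel) + (\<integral>\<^sup>+t. ennreal (?f v t \<omega>) \<partial>lborel)
        = (\<integral>\<^sup>+t. ennreal (?f u t \<omega>) + ennreal (?f v t \<omega>) \<partial>lborel)"
      by (rule nn_integral_add[symmetric]) (use w in measurable)
    also have "\<dots> = (\<integral>\<^sup>+t. 2 * ennreal (?f m t \<omega>) + 2 * ennreal (gap u v t \<omega>) \<partial>lborel)"
      by (simp only: pt)
    also have "\<dots> = 2 * (\<integral>\<^sup>+t. ennreal (?f m t \<omega>) \<partial>lborel) + 2 * (\<integral>\<^sup>+t. ennreal (gap u v t \<omega>) \<partial>lborel)"
      using w by (subst nn_integral_add, measurable, measurable, subst (1 2) nn_integral_cmult) measurable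
    finally show ?thesis .
  qed
  have "J M T a W z F u + J M T a W z F v
      = (\<integral>\<^sup>+\<omega>. (\<integral>\<^sup>+t. ennreal (?f u t \<omega>) \<partial>lborel) + (\<integral>\<^sup>+t. ennreal (?f v t \<omega>) \<partial>lborel) \<partial>M)"
    unfolding J_indicator_form by (rule nn_integral_add[symmetric]) measurable
  also have "\<dots> = (\<integral>\<^sup>+\<omega>. 2 * (\<integral>\<^sup>+t. ennreal (?f m t \<omega>) \<partial>lborel) + 2 * (\<integral>\<^sup>+t. ennreal (gap u v t \<omega>) \<partial>lborel) \<partial>M)"
    using z by (intro nn_integral_cong_AE) (auto simp: path)
  also have "\<dots> = 2 * J M T a W z F m + 2 * (\<integral>\<^sup>+\<omega>. (\<integral>\<^sup>+t. ennreal (gap u v t \<omega>) \<partial>lborel) \<partial>M)"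
    unfolding J_indicator_form by (subst nn_integral_add, measurable, measurable, subst (1 2) nn_integral_cmult) measurable
  finally show ?thesis unfolding m_def .
qed

text \<open>Minimality of \<open>v\<close> at the midpoint control bounds the integrated defect by the excess \<open>e n\<close>. Since the
  excesses are summable, the series of defects is integrable, so its terms tend to \<open>0\<close> almost everywhere
  along the whole sequence.\<close>

lemma minimizing_sequence_state_converges:
  assumes conv: "\<And>t. t \<in> {0..T} \<Longrightarrow> convex_on UNIV (F t)"
    and strict: "\<And>t. t \<in> {0..T} \<Longrightarrow> strictly_convex (F t)"
    and z: "AE \<omega> in M. set_integrable lborel {0..T} (\<lambda>s. z s \<omega>)"
    and u: "\<And>n. u n \<in> L1 T" and v: "v \<in> L1 T"
    and v_min: "\<And>w. w \<in> L1 T \<Longrightarrow> J M T a W z F v \<le> J M T a W z F w" and v_fin: "J M T a W z F v < \<infinity>"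
    and excess: "\<And>n. J M T a W z F (u n) \<le> J M T a W z F v + e n" and e: "(\<Sum>n. e n) < \<infinity>"
  shows "AE \<omega> in M. AE t in lborel. t \<in> {0..T} \<longrightarrow> (\<lambda>n. \<xi> a W z (u n) t \<omega>) \<longlonglongrightarrow> \<xi> a W z v t \<omega>"
proof -
  note [measurable] = gap_measurable[OF u v]
  let ?g = "\<lambda>n. \<integral>\<^sup>+\<omega>. (\<integral>\<^sup>+t. ennreal (gap (u n) v t \<omega>) \<partial>lborel) \<partial>M"
  have "?g n \<le> e n" for n
  proof -
    let ?m = "\<lambda>s. (u n s + v s) / 2"
    have "2 * J M T a W z F v + ?g n \<le> 2 * J M T a W z F ?m + 2 * ?g n"
      by (intro add_mono mult_left_mono v_min L1_midpoint u v) (auto simp: mult_2)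
    also have "\<dots> = J M T a W z F (u n) + J M T a W z F v"
      by (rule J_midpoint_identity[OF conv z u v, symmetric])
    also have "\<dots> \<le> (J M T a W z F v + e n) + J M T a W z F v" by (intro add_mono excess) auto
    also have "\<dots> = 2 * J M T a W z F v + e n" by (simp add: mult_2 ac_simps)
    finally show ?thesis using v_fin by (auto simp: ennreal_add_left_cancel_le ennreal_mult_eq_top_iff)
  qed
  then have "(\<Sum>n. ?g n) \<le> (\<Sum>n. e n)" by (intro suminf_le) auto
  also have "(\<Sum>n. ?g n) = (\<integral>\<^sup>+\<omega>. (\<Sum>n. \<integral>\<^sup>+t. ennreal (gap (u n) v t \<omega>) \<partial>lborel) \<partial>M)"
    by (rule nn_integral_suminf[symmetric]) measurable
  finally have "AE \<omega> in M. (\<Sum>n. \<integral>\<^sup>+t. ennreal (gap (u n) v t \<omega>) \<partial>lborel) \<noteq> \<infinity>"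
    using e by (intro nn_integral_PInf_AE) auto
  then show ?thesis using z AE_space
  proof eventually_elim
    case (elim \<omega>)
    note w = elim(3) and zw = elim(2)
    have "(\<Sum>n. \<integral>\<^sup>+t. ennreal (gap (u n) v t \<omega>) \<partial>lborel) = (\<integral>\<^sup>+t. (\<Sum>n. ennreal (gap (u n) v t \<omega>)) \<partial>lborel)"
      by (rule nn_integral_suminf[symmetric]) (use w in measurable)
    then have "AE t in lborel. (\<Sum>n. ennreal (gap (u n) v t \<omega>)) \<noteq> \<infinity>"
      using elim(1) w by (intro nn_integral_PInf_AE) auto
    then show ?case
    proof eventually_elim
      case (elim t)
      show ?case
      proof
        assume t: "t \<in> {0..T}"
        have "summable (\<lambda>n. gap (u n) v t \<omega>)"
          using elim by (intro summable_suminf_not_top gap_nonneg[OF conv w zw u v]) auto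
        from summable_LIMSEQ_zero[OF this]
        have "(\<lambda>n. (F t (\<xi> a W z (u n) t \<omega>) + F t (\<xi> a W z v t \<omega>)) / 2
            - F t ((\<xi> a W z (u n) t \<omega> + \<xi> a W z v t \<omega>) / 2)) \<longlonglongrightarrow> 0"
          using t by (simp add: gap_def xi_midpoint[OF w zw u v t])
        then show "(\<lambda>n. \<xi> a W z (u n) t \<omega>) \<longlonglongrightarrow> \<xi> a W z v t \<omega>"
          by (rule midpoint_gap_tendsto_zero[OF conv[OF t] strict[OF t]])
      qed
    qed
  qed
qed

section \<open>From convergence of the states to weak convergence of the controls\<close>

text \<open>Because the controls are deterministic, a single path \<open>\<omega>\<close> determines the weak limit: by \<open>xi_diff\<close> the states
  encode the primitives of \<open>h s \<omega> * (u n s - v s)\<close>, and a test function \<open>g\<close> for the controls becomes the bounded test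
  function \<open>g / h\<close> for these products.\<close>

lemma state_converges_imp_weak_limit:
  assumes \<Psi>: "young_function \<Psi>" and C: "\<And>n. FPsi T \<Psi> (u n) \<le> ennreal C"
    and u: "\<And>n. u n \<in> L1 T" and v: "v \<in> L1 T"
    and w: "\<omega> \<in> space M" and z: "set_integrable lborel {0..T} (\<lambda>s. z s \<omega>)"
    and lim: "AE t in lborel. t \<in> {0..T} \<longrightarrow> (\<lambda>n. \<xi> a W z (u n) t \<omega>) \<longlonglongrightarrow> \<xi> a W z v t \<omega>"
  shows "weak_L1_limit T u v"
  unfolding weak_L1_limit_def
proof (intro conjI allI ballI u v)
  fix g assume g: "g \<in> Linf T"
  obtain c H where H: "0 < c" "0 < H" "\<And>s. s \<in> {0..T} \<Longrightarrow> c \<le> h s \<omega>" "\<And>s. s \<in> {0..T} \<Longrightarrow> h s \<omega> \<le> H"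
    using h_bounds[OF w] by blast
  note [measurable] = h_path_measurable[OF w] L1_measurable[OF u] L1_measurable[OF v]
  define q where "q n s = indicator {0..T} s * (h s \<omega> * (u n s - v s))" for n s
  have diff: "set_integrable lborel {0..T} (\<lambda>s. u n s - v s)" for n
    using u v by (auto simp: L1_def)
  have q_int: "integrable lborel (q n)" for n
    using h_mult_integrable[OF w diff, of T n] by (simp add: set_integrable_def q_def[abs_def])
  obtain K where K: "AE t in lborel. t \<in> {0..T} \<longrightarrow> \<bar>g t\<bar> \<le> K" using g by (auto simp: Linf_def)
  have [measurable]: "(\<lambda>s. indicator {0..T} s * g s) \<in> borel_measurable borel"
    using g by (auto simp: Linf_def set_borel_measurable_def)
  \<comment> \<open>The test function is bounded only almost everywhere; clipping makes it bounded everywhere.\<close>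
  define clip where "clip s = max (- \<bar>K\<bar>) (min \<bar>K\<bar> (indicator {0..T} s * g s))" for s
  have clip: "\<bar>clip s\<bar> \<le> \<bar>K\<bar>" for s by (auto simp: clip_def)
  have clip_eq: "AE s in lborel. s \<in> {0..T} \<longrightarrow> clip s = g s"
    using K by eventually_elim (auto simp: clip_def)
  have [measurable]: "clip \<in> borel_measurable borel" unfolding clip_def[abs_def] by measurable
  define \<phi> where "\<phi> s = indicator {0..T} s * (clip s / (indicator {0..T} s * h s \<omega>))" for s
  have "(\<lambda>n. \<integral>s. q n s * \<phi> s \<partial>lborel) \<longlonglongrightarrow> 0"
  proof (rule unif_integrable_weak_null[where T=T and w=q and g=\<phi> and K="\<bar>K\<bar> / c"])
    show "q n s = 0" if "s \<notin> {0..T}" for n s using that by (simp add: q_def)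
    show "\<phi> \<in> borel_measurable borel" unfolding \<phi>_def[abs_def] by measurable
    show "\<bar>\<phi> s\<bar> \<le> \<bar>K\<bar> / c" for s
    proof (cases "s \<in> {0..T}")
      case True
      then show ?thesis using frac_le[OF abs_ge_zero clip[of s] H(1) H(3)[OF True]] integrating_factor_pos[of a W s \<omega>]
        by (simp add: \<phi>_def abs_divide)
    qed (use H in \<open>simp add: \<phi>_def\<close>)
    show "AE t in lborel. t \<in> {0..T} \<longrightarrow> (\<lambda>n. \<integral>s. q n s * indicator {..t} s \<partial>lborel) \<longlonglongrightarrow> 0"
      using lim
    proof eventually_elim
      case (elim t)
      show ?case
      proof
        assume t: "t \<in> {0..T}"
        have "(\<integral>s. q n s * indicator {..t} s \<partial>lborel) = h t \<omega> * (\<xi> a W z v t \<omega> - \<xi> a W z (u n) t \<omega>)" for n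
          unfolding xi_diff[OF w z u v t] set_lebesgue_integral_def
          using t by (intro Bochner_Integration.integral_cong) (auto simp: q_def indicator_def)
        moreover have "(\<lambda>n. h t \<omega> * (\<xi> a W z v t \<omega> - \<xi> a W z (u n) t \<omega>)) \<longlonglongrightarrow> h t \<omega> * (\<xi> a W z v t \<omega> - \<xi> a W z v t \<omega>)"
          using elim t by (intro tendsto_intros) auto
        ultimately show "(\<lambda>n. \<integral>s. q n s * indicator {..t} s \<partial>lborel) \<longlonglongrightarrow> 0" by simp
      qed
    qed
    fix e :: real assume e: "0 < e"
    \<comment> \<open>The slope in \<open>x \<le> K + \<epsilon> * \<Psi> x\<close> is chosen so that the \<open>\<Psi>\<close>-part of \<open>q n\<close> has integral at most \<open>e\<close>; the rest
      is dominated by one integrable function.\<close>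
    define \<epsilon> where "\<epsilon> = e / (H * (\<bar>C\<bar> + 1))"
    have \<epsilon>: "0 < \<epsilon>" "H * \<epsilon> * \<bar>C\<bar> \<le> e"
    proof -
      show "0 < \<epsilon>" unfolding \<epsilon>_def using e H(2) by (intro divide_pos_pos mult_pos_pos) auto
      have "H * \<epsilon> * \<bar>C\<bar> = e * (\<bar>C\<bar> / (\<bar>C\<bar> + 1))" using H(2) by (simp add: \<epsilon>_def)
      also have "\<dots> \<le> e * 1" using e by (intro mult_left_mono) auto
      finally show "H * \<epsilon> * \<bar>C\<bar> \<le> e" by simp
    qed
    obtain K where K: "0 \<le> K" "\<And>x. 0 \<le> x \<Longrightarrow> x \<le> K + \<epsilon> * \<Psi> x" using young_function_superlinear[OF \<Psi> \<epsilon>(1)] by blast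
    define r where "r n s = H * \<epsilon> * (indicator {0..T} s * \<Psi> \<bar>u n s\<bar>)" for n s
    have \<Psi>_nonneg: "0 \<le> indicator {0..T} s * \<Psi> \<bar>u n s\<bar>" for n s
      using young_function_nonneg[OF \<Psi>, of "\<bar>u n s\<bar>"] by simp
    have bound: "(\<integral>\<^sup>+s. ennreal (indicator {0..T} s * \<Psi> \<bar>u n s\<bar>) \<partial>lborel) \<le> ennreal \<bar>C\<bar>" for n
    proof -
      have "(\<integral>\<^sup>+s. ennreal (indicator {0..T} s * \<Psi> \<bar>u n s\<bar>) \<partial>lborel) = FPsi T \<Psi> (u n)"
        unfolding FPsi_def by (intro nn_integral_cong) (auto simp: indicator_def)
      also have "\<dots> \<le> ennreal \<bar>C\<bar>" using C[of n] by (rule order_trans) (intro ennreal_leI abs_ge_self)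
      finally show ?thesis .
    qed
    have meas: "(\<lambda>s. indicator {0..T} s * \<Psi> \<bar>u n s\<bar>) \<in> borel_measurable lborel" for n
    proof -
      have "(\<lambda>s. \<Psi> \<bar>indicator {0..T} s * u n s\<bar>) \<in> borel_measurable borel"
        by (rule young_function_measurable[OF \<Psi>]) measurable
      then have "(\<lambda>s. indicator {0..T} s * \<Psi> \<bar>indicator {0..T} s * u n s\<bar>) \<in> borel_measurable borel"
        by measurable
      moreover have "indicator {0..T} s * \<Psi> \<bar>indicator {0..T} s * u n s\<bar> = indicator {0..T} s * \<Psi> \<bar>u n s\<bar>" for s
        by (auto simp: indicator_def)
      ultimately show ?thesis by simp
    qed
    have int: "integrable lborel (\<lambda>s. indicator {0..T} s * \<Psi> \<bar>u n s\<bar>)" for n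
      by (rule integrableI_nonneg[OF meas]) (use \<Psi>_nonneg bound[of n] in \<open>auto intro: le_less_trans\<close>)
    have int_le: "(\<integral>s. indicator {0..T} s * \<Psi> \<bar>u n s\<bar> \<partial>lborel) \<le> \<bar>C\<bar>" for n
      using bound[of n] nn_integral_eq_integral[OF int[of n]] \<Psi>_nonneg by (simp add: ennreal_le_iff)
    have "integrable lborel (\<lambda>s. H * (K * indicator {0..T} s + indicator {0..T} s *\<^sub>R \<bar>v s\<bar>))"
      using set_integrable_abs[of lborel "{0..T}" v] v
      by (auto simp: L1_def set_integrable_def emeasure_lborel_Icc_eq
          intro!: integrable_mult_right Bochner_Integration.integrable_add integrable_real_indicator)
    moreover have "\<bar>q n s\<bar> \<le> H * (K * indicator {0..T} s + indicator {0..T} s *\<^sub>R \<bar>v s\<bar>) + r n s" for n s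
    proof (cases "s \<in> {0..T}")
      case True
      have "\<bar>q n s\<bar> = h s \<omega> * \<bar>u n s - v s\<bar>"
        using True integrating_factor_pos[of a W s \<omega>] by (simp add: q_def abs_mult)
      also have "\<dots> \<le> H * (\<bar>u n s\<bar> + \<bar>v s\<bar>)"
        using H(2) H(4)[OF True] by (intro mult_mono) auto
      also have "\<dots> \<le> H * ((K + \<epsilon> * \<Psi> \<bar>u n s\<bar>) + \<bar>v s\<bar>)"
        using K(2)[of "\<bar>u n s\<bar>"] H(2) by (intro mult_left_mono) auto
      finally show ?thesis using True by (simp add: r_def algebra_simps)
    qed (simp add: q_def r_def)
    moreover have "integrable lborel (r n)" for n unfolding r_def[abs_def] using int[of n] by simp
    moreover have "0 \<le> r n s" for n s unfolding r_def using H(2) \<epsilon>(1) \<Psi>_nonneg[of s n] by simp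
    moreover have "(\<integral>s. r n s \<partial>lborel) \<le> e" for n
    proof -
      have "(\<integral>s. r n s \<partial>lborel) = H * \<epsilon> * (\<integral>s. indicator {0..T} s * \<Psi> \<bar>u n s\<bar> \<partial>lborel)"
        unfolding r_def by simp
      also have "\<dots> \<le> H * \<epsilon> * \<bar>C\<bar>" using H(2) \<epsilon>(1) int_le[of n] by (intro mult_left_mono) auto
      finally show ?thesis using \<epsilon>(2) by simp
    qed
    ultimately show "\<exists>k. integrable lborel k \<and> (\<forall>n. \<exists>r. integrable lborel r \<and> (\<forall>x. 0 \<le> r x)
        \<and> (\<forall>x. \<bar>q n x\<bar> \<le> k x + r x) \<and> (\<integral>x. r x \<partial>lborel) \<le> e)"
      by (intro exI[of _ "\<lambda>s. H * (K * indicator {0..T} s + indicator {0..T} s *\<^sub>R \<bar>v s\<bar>)"] conjI allI exI[of _ "r _"]) auto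
  qed (use T_pos q_int in auto)
  moreover have "(\<integral>s. q n s * \<phi> s \<partial>lborel) = (LINT t:{0..T}|lborel. u n t * g t) - (LINT t:{0..T}|lborel. v t * g t)" for n
  proof -
    have int: "integrable lborel (\<lambda>s. indicator {0..T} s *\<^sub>R (f s * g s))" if f: "f \<in> L1 T" for f
    proof (rule Bochner_Integration.integrable_bound)
      note [measurable] = L1_measurable[OF f]
      show "integrable lborel (\<lambda>s. K * (indicator {0..T} s *\<^sub>R f s))"
        using f by (simp add: L1_def set_integrable_def)
      have "(\<lambda>s. (indicator {0..T} s * f s) * (indicator {0..T} s * g s)) \<in> borel_measurable lborel" by measurable
      moreover have "(indicator {0..T} s * f s) * (indicator {0..T} s * g s) = indicator {0..T} s *\<^sub>R (f s * g s)" for s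
        by (auto simp: indicator_def)
      ultimately show "(\<lambda>s. indicator {0..T} s *\<^sub>R (f s * g s)) \<in> borel_measurable lborel" by (simp only:)
      show "AE s in lborel. norm (indicator {0..T} s *\<^sub>R (f s * g s)) \<le> norm (K * (indicator {0..T} s *\<^sub>R f s))"
        using K
      proof eventually_elim
        case (elim s)
        then show ?case using mult_left_mono[of "\<bar>g s\<bar>" "\<bar>K\<bar>" "\<bar>f s\<bar>"]
          by (auto simp: indicator_def abs_mult mult.commute)
      qed
    qed
    have "(LINT t:{0..T}|lborel. u n t * g t) - (LINT t:{0..T}|lborel. v t * g t)
       = (\<integral>s. indicator {0..T} s *\<^sub>R (u n s * g s) - indicator {0..T} s *\<^sub>R (v s * g s) \<partial>lborel)"
      unfolding set_lebesgue_integral_def by (rule Bochner_Integration.integral_diff[symmetric]; rule int; rule u v)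
    also have "\<dots> = (\<integral>s. q n s * \<phi> s \<partial>lborel)"
    proof (rule integral_cong_AE)
      show "(\<lambda>s. indicator {0..T} s *\<^sub>R (u n s * g s) - indicator {0..T} s *\<^sub>R (v s * g s)) \<in> borel_measurable lborel"
        using int[OF u] int[OF v] by (intro borel_measurable_diff borel_measurable_integrable) auto
      show "(\<lambda>s. q n s * \<phi> s) \<in> borel_measurable lborel"
        using borel_measurable_integrable[OF q_int[of n]] unfolding \<phi>_def by measurable
      show "AE s in lborel. indicator {0..T} s *\<^sub>R (u n s * g s) - indicator {0..T} s *\<^sub>R (v s * g s) = q n s * \<phi> s"
        using clip_eq
      proof eventually_elim
        case (elim s)
        then show ?case using integrating_factor_pos[of a W s \<omega>]
          by (auto simp: q_def \<phi>_def indicator_def field_simps)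
      qed
    qed
    finally show ?thesis by simp
  qed
  ultimately show "(\<lambda>n. LINT t:{0..T}|lborel. u n t * g t) \<longlonglongrightarrow> (LINT t:{0..T}|lborel. v t * g t)"
    by (simp add: LIM_zero_iff)
qed

section \<open>Finiteness of the cost\<close>

lemma z_measurable: "s \<in> {0..T} \<Longrightarrow> z s \<in> borel_measurable M"
proof -
  assume "s \<in> {0..T}"
  then have "z s = (\<lambda>\<omega>. indicator {0..T} s * z s \<omega>)" by (simp add: fun_eq_iff)
  also have "\<dots> \<in> borel_measurable M" by measurable
  finally show ?thesis .
qed

text \<open>The function \<open>m\<close> dominates the \<open>p\<close>-th norms of \<open>z\<close>. By \<open>le_add_weighted_powr\<close> the mean of
  \<open>\<bar>z s\<bar>\<close> is at most \<open>2 * m s\<close>, and Fubini gives integrability of almost every path.\<close>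

lemma AE_z_path_integrable:
  fixes m :: "real \<Rightarrow> real"
  assumes p: "1 \<le> p" and m[measurable]: "m \<in> borel_measurable borel" and m_pos: "\<And>s. 0 < m s"
    and m_int: "set_integrable lborel {0..T} m"
    and zm: "\<And>s. s \<in> {0..T} \<Longrightarrow> (\<integral>\<^sup>+\<omega>. ennreal (\<bar>z s \<omega>\<bar> powr p) \<partial>M) \<le> ennreal (m s powr p)"
  shows "AE \<omega> in M. set_integrable lborel {0..T} (\<lambda>s. z s \<omega>)"
proof -
  interpret pair_sigma_finite lborel M ..
  have m_int': "integrable lborel (\<lambda>s. indicator {0..T} s * m s)" using m_int by (simp add: set_integrable_def)
  have m_fin: "(\<integral>\<^sup>+s. ennreal (indicator {0..T} s * m s) \<partial>lborel) < \<infinity>"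
    by (subst nn_integral_eq_integral[OF m_int']) (auto simp: less_imp_le m_pos)
  let ?z = "\<lambda>s \<omega>. indicator {0..T} s * z s \<omega>"
  have path: "(\<integral>\<^sup>+\<omega>. ennreal \<bar>?z s \<omega>\<bar> \<partial>M) \<le> 2 * ennreal (indicator {0..T} s * m s)" for s
  proof (cases "s \<in> {0..T}")
    case s: True
    note [measurable] = z_measurable[OF s]
    have "(\<integral>\<^sup>+\<omega>. ennreal \<bar>?z s \<omega>\<bar> \<partial>M) \<le> (\<integral>\<^sup>+\<omega>. ennreal (m s) + ennreal (m s powr (1 - p)) * ennreal (\<bar>z s \<omega>\<bar> powr p) \<partial>M)"
    proof (rule nn_integral_mono)
      fix \<omega>
      have "ennreal \<bar>?z s \<omega>\<bar> \<le> ennreal (m s + m s powr (1 - p) * \<bar>z s \<omega>\<bar> powr p)"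
        using le_add_weighted_powr[of "\<bar>z s \<omega>\<bar>" "m s" p] m_pos[of s] p s by (intro ennreal_leI) simp
      also have "\<dots> = ennreal (m s) + ennreal (m s powr (1 - p)) * ennreal (\<bar>z s \<omega>\<bar> powr p)"
        using m_pos[of s] by (simp add: ennreal_mult')
      finally show "ennreal \<bar>?z s \<omega>\<bar> \<le> ennreal (m s) + ennreal (m s powr (1 - p)) * ennreal (\<bar>z s \<omega>\<bar> powr p)" .
    qed
    also have "\<dots> = ennreal (m s) + ennreal (m s powr (1 - p)) * (\<integral>\<^sup>+\<omega>. ennreal (\<bar>z s \<omega>\<bar> powr p) \<partial>M)"
      by (subst nn_integral_add) (auto simp: nn_integral_cmult emeasure_space_1)
    also have "\<dots> \<le> ennreal (m s) + ennreal (m s powr (1 - p)) * ennreal (m s powr p)"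
      by (intro add_left_mono mult_left_mono zm s) auto
    also have "\<dots> = 2 * ennreal (m s)"
      using m_pos[of s] by (simp add: ennreal_mult'[symmetric] powr_add[symmetric] mult_2)
    finally show ?thesis using s by simp
  qed simp
  have "(\<integral>\<^sup>+\<omega>. (\<integral>\<^sup>+s. ennreal \<bar>?z s \<omega>\<bar> \<partial>lborel) \<partial>M) = (\<integral>\<^sup>+s. (\<integral>\<^sup>+\<omega>. ennreal \<bar>?z s \<omega>\<bar> \<partial>M) \<partial>lborel)"
    by (rule Fubini') measurable
  also have "\<dots> \<le> (\<integral>\<^sup>+s. 2 * ennreal (indicator {0..T} s * m s) \<partial>lborel)"
    by (intro nn_integral_mono path)
  also have "\<dots> = 2 * (\<integral>\<^sup>+s. ennreal (indicator {0..T} s * m s) \<partial>lborel)" by (rule nn_integral_cmult) measurable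
  also have "\<dots> < \<infinity>" using m_fin by (simp add: ennreal_mult_less_top)
  finally have "AE \<omega> in M. (\<integral>\<^sup>+s. ennreal \<bar>?z s \<omega>\<bar> \<partial>lborel) \<noteq> \<infinity>"
    by (intro nn_integral_PInf_AE) auto
  then show ?thesis using AE_space
  proof eventually_elim
    case (elim \<omega>)
    then have "integrable lborel (\<lambda>s. ?z s \<omega>)"
      by (intro integrableI_bounded) (auto simp: less_top)
    then show ?case by (simp add: set_integrable_def)
  qed
qed

text \<open>On \<open>s \<le> t\<close> the quotient of integrating factors is at most a constant times \<open>exp (W t - W s)\<close>. The weighted
  Hoelder inequality along each path, followed by Fubini, reduces the \<open>p\<close>-th moment of the state to the
  assumed moments \<open>zm\<close>; the weights cancel to \<open>m\<close>, whose integral is finite. The resulting bound does not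
  depend on \<open>t\<close>, so it can be integrated against \<open>L\<close>.\<close>

lemma J_zero_finite:
  fixes m L :: "real \<Rightarrow> real"
  assumes p: "1 \<le> p" and m[measurable]: "m \<in> borel_measurable borel" and m_pos: "\<And>s. 0 < m s"
    and m_int: "set_integrable lborel {0..T} m"
    and zm: "\<And>s t. 0 \<le> s \<Longrightarrow> s \<le> t \<Longrightarrow> t \<le> T \<Longrightarrow>
      (\<integral>\<^sup>+\<omega>. ennreal (exp (p * (W t \<omega> - W s \<omega>))) * ennreal (\<bar>z s \<omega>\<bar> powr p) \<partial>M) \<le> ennreal C * ennreal (m s powr p)"
    and L: "L \<in> L1 T" "\<And>t. t \<in> {0..T} \<Longrightarrow> 0 \<le> L t"
    and growth: "\<And>t x. t \<in> {0..T} \<Longrightarrow> F t x \<le> L t * (2 + \<bar>x\<bar> powr p)"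
  shows "J M T a W z F (\<lambda>_. 0) < \<infinity>"
proof -
  interpret pair_sigma_finite lborel M ..
  let ?x = "\<xi> a W z (\<lambda>_. 0)"
  define B where "B = (LINT s:{0..T}|lborel. \<bar>a s\<bar>)"
  define K where "K = (LINT s:{0..T}|lborel. m s)"
  note B = A_bounded[OF a_int, folded B_def]
  note [measurable] = L1_measurable[OF L(1)]
  have zero: "(\<lambda>_. 0) \<in> L1 T" by (simp add: L1_def set_integrable_def)
  note [measurable] = xi_measurable[OF zero]
  have m_int': "integrable lborel (\<lambda>s. indicator {0..T} s * m s)" using m_int by (simp add: set_integrable_def)
  have m_fin: "(\<integral>\<^sup>+s. ennreal (indicator {0..T} s * m s) \<partial>lborel) = ennreal K"
    unfolding K_def set_lebesgue_integral_def real_scaleR_def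
    by (rule nn_integral_eq_integral[OF m_int']) (auto simp: less_imp_le m_pos)
  \<comment> \<open>\<open>\<rho> t s\<close> bounds the weighted \<open>p\<close>-th power of the integrand at time \<open>s\<close>; its factor \<open>\<kappa> t s\<close> is deterministic,
    which isolates the moment controlled by \<open>zm\<close>.\<close>
  define \<kappa> where "\<kappa> t s = (if 0 \<le> s \<and> s \<le> t then m s powr (1 - p) * exp (2 * B * p) else 0)" for t s
  define \<rho> where "\<rho> t s \<omega> = \<kappa> t s * (exp (p * (W t \<omega> - W s \<omega>)) * \<bar>indicator {0..T} s * z s \<omega>\<bar> powr p)" for t s \<omega>
  have \<kappa>_nonneg: "0 \<le> \<kappa> t s" for t s by (simp add: \<kappa>_def)
  have \<kappa>_meas[measurable]: "\<kappa> t \<in> borel_measurable borel" for t unfolding \<kappa>_def[abs_def] by measurable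
  have path: "ennreal (\<bar>?x t \<omega>\<bar> powr p) \<le> ennreal (K powr (p - 1)) * (\<integral>\<^sup>+s. ennreal (\<rho> t s \<omega>) \<partial>lborel)"
    if t: "t \<in> {0..T}" and w: "\<omega> \<in> space M" for t \<omega>
  proof -
    let ?N = "restrict_space lborel {0..T}"
    note [measurable] = h_path_measurable[OF w]
    define f where "f s = indicator {0..t} s * ((indicator {0..T} s * h s \<omega>) * \<bar>indicator {0..T} s * z s \<omega>\<bar> / h t \<omega>)" for s
    have f_meas: "f \<in> borel_measurable lborel" unfolding f_def[abs_def] using w by measurable
    have f_nonneg: "0 \<le> f s" for s unfolding f_def using integrating_factor_pos[of a W _ \<omega>] by (auto simp: less_imp_le)
    have xf: "\<bar>?x t \<omega>\<bar> \<le> (\<integral>s. f s \<partial>?N)"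
    proof -
      have "?x t \<omega> = (\<integral>s. indicator {0..t} s * (h s \<omega> * z s \<omega> / h t \<omega>) \<partial>lborel)"
        unfolding xi_eq_integrating_factor set_lebesgue_integral_def by (simp flip: integral_divide_zero)
      then have "\<bar>?x t \<omega>\<bar> \<le> (\<integral>s. \<bar>indicator {0..t} s * (h s \<omega> * z s \<omega> / h t \<omega>)\<bar> \<partial>lborel)"
        by (simp only: integral_abs_bound)
      also have "\<dots> = (\<integral>s. indicator {0..T} s *\<^sub>R f s \<partial>lborel)"
        using t by (intro Bochner_Integration.integral_cong)
          (auto simp: f_def indicator_def abs_mult abs_of_pos[OF integrating_factor_pos])
      also have "\<dots> = (\<integral>s. f s \<partial>?N)" by (rule integral_restrict_space[symmetric]) simp
      finally show ?thesis .
    qed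
    have "\<bar>?x t \<omega>\<bar> powr p \<le> (\<integral>s. f s \<partial>?N) powr p" using xf p by (intro powr_mono2) auto
    then have "ennreal (\<bar>?x t \<omega>\<bar> powr p) \<le> ennreal ((\<integral>s. f s \<partial>?N) powr p)" by (rule ennreal_leI)
    also have "\<dots> \<le> ennreal ((\<integral>s. m s \<partial>?N) powr (p - 1)) * (\<integral>\<^sup>+s. ennreal (m s powr (1 - p) * f s powr p) \<partial>?N)"
      by (rule weighted_hoelder[OF p _ m_pos _ f_nonneg])
        (use m_int f_meas in \<open>auto simp: integrable_restrict_space set_integrable_def intro: measurable_restrict_space1\<close>)
    also have "(\<integral>s. m s \<partial>?N) = K" unfolding K_def set_lebesgue_integral_def by (rule integral_restrict_space) simp
    also have "(\<integral>\<^sup>+s. ennreal (m s powr (1 - p) * f s powr p) \<partial>?N)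
        = (\<integral>\<^sup>+s. ennreal (m s powr (1 - p) * f s powr p) * indicator {0..T} s \<partial>lborel)"
      by (rule nn_integral_restrict_space) simp
    also have "\<dots> \<le> (\<integral>\<^sup>+s. ennreal (\<rho> t s \<omega>) \<partial>lborel)"
    proof (rule nn_integral_mono)
      fix s
      show "ennreal (m s powr (1 - p) * f s powr p) * indicator {0..T} s \<le> ennreal (\<rho> t s \<omega>)"
      proof (cases "0 \<le> s \<and> s \<le> t")
        case True
        then have s: "s \<in> {0..T}" using t by auto
        have "h s \<omega> / h t \<omega> = exp (A a t - A a s + (s - t) / 2 + (W t \<omega> - W s \<omega>))"
          by (simp add: integrating_factor_def G_def exp_diff[symmetric] diff_divide_distrib algebra_simps)
        also have "\<dots> \<le> exp (2 * B + (W t \<omega> - W s \<omega>))"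
        proof -
          have "(s - t) / 2 \<le> 0" using True by simp
          then show ?thesis
            using abs_le_D1[OF B[OF t]] abs_le_D2[OF B[OF s]] unfolding exp_le_cancel_iff by linarith
        qed
        finally have hh: "h s \<omega> / h t \<omega> \<le> exp (2 * B) * exp (W t \<omega> - W s \<omega>)" by (simp add: exp_add)
        have "f s = (h s \<omega> / h t \<omega>) * \<bar>indicator {0..T} s * z s \<omega>\<bar>" using True s by (simp add: f_def)
        also have "\<dots> \<le> (exp (2 * B) * exp (W t \<omega> - W s \<omega>)) * \<bar>indicator {0..T} s * z s \<omega>\<bar>"
          by (rule mult_right_mono[OF hh]) simp
        finally have "f s powr p \<le> ((exp (2 * B) * exp (W t \<omega> - W s \<omega>)) * \<bar>indicator {0..T} s * z s \<omega>\<bar>) powr p"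
          using f_nonneg[of s] p by (intro powr_mono2) auto
        also have "\<dots> = exp (2 * B * p) * (exp (p * (W t \<omega> - W s \<omega>)) * \<bar>indicator {0..T} s * z s \<omega>\<bar> powr p)"
          by (simp add: powr_mult exp_powr_real mult.commute mult.left_commute)
        finally have "m s powr (1 - p) * f s powr p \<le> m s powr (1 - p) *
            (exp (2 * B * p) * (exp (p * (W t \<omega> - W s \<omega>)) * \<bar>indicator {0..T} s * z s \<omega>\<bar> powr p))"
          by (intro mult_left_mono) auto
        then have "m s powr (1 - p) * f s powr p \<le> \<rho> t s \<omega>"
          using True unfolding \<rho>_def \<kappa>_def by (simp only: if_True simp_thms mult.assoc)
        then show ?thesis using s by (simp add: ennreal_leI)
      next
        case False
        then have "f s = 0" by (auto simp: f_def indicator_def)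
        then show ?thesis by simp
      qed
    qed
    finally show ?thesis by (simp add: mult_left_mono)
  qed
  have moment: "(\<integral>\<^sup>+\<omega>. ennreal (\<bar>indicator {0..T} t * ?x t \<omega>\<bar> powr p) \<partial>M)
      \<le> ennreal (K powr (p - 1)) * (ennreal (exp (2 * B * p)) * ennreal C * ennreal K)" (is "_ \<le> ?Q")
    if t: "t \<in> {0..T}" for t
  proof -
    have [measurable]: "(\<lambda>(s, \<omega>). \<rho> t s \<omega>) \<in> borel_measurable (lborel \<Otimes>\<^sub>M M)" unfolding \<rho>_def by measurable
    have "(\<integral>\<^sup>+\<omega>. ennreal (\<bar>indicator {0..T} t * ?x t \<omega>\<bar> powr p) \<partial>M)
        \<le> (\<integral>\<^sup>+\<omega>. ennreal (K powr (p - 1)) * (\<integral>\<^sup>+s. ennreal (\<rho> t s \<omega>) \<partial>lborel) \<partial>M)"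
      using path[OF t] t by (intro nn_integral_mono) simp
    also have "\<dots> = ennreal (K powr (p - 1)) * (\<integral>\<^sup>+\<omega>. (\<integral>\<^sup>+s. ennreal (\<rho> t s \<omega>) \<partial>lborel) \<partial>M)"
      by (rule nn_integral_cmult) measurable
    also have "(\<integral>\<^sup>+\<omega>. (\<integral>\<^sup>+s. ennreal (\<rho> t s \<omega>) \<partial>lborel) \<partial>M) = (\<integral>\<^sup>+s. (\<integral>\<^sup>+\<omega>. ennreal (\<rho> t s \<omega>) \<partial>M) \<partial>lborel)"
      by (rule Fubini') measurable
    also have "\<dots> \<le> (\<integral>\<^sup>+s. ennreal (exp (2 * B * p)) * ennreal C * ennreal (indicator {0..T} s * m s) \<partial>lborel)"
    proof (rule nn_integral_mono)
      fix s
      show "(\<integral>\<^sup>+\<omega>. ennreal (\<rho> t s \<omega>) \<partial>M) \<le> ennreal (exp (2 * B * p)) * ennreal C * ennreal (indicator {0..T} s * m s)"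
      proof (cases "0 \<le> s \<and> s \<le> t")
        case True
        then have s: "s \<in> {0..T}" using t by auto
        note [measurable] = z_measurable[OF s]
        have "(\<integral>\<^sup>+\<omega>. ennreal (\<rho> t s \<omega>) \<partial>M)
            = (\<integral>\<^sup>+\<omega>. ennreal (\<kappa> t s) * (ennreal (exp (p * (W t \<omega> - W s \<omega>))) * ennreal (\<bar>z s \<omega>\<bar> powr p)) \<partial>M)"
          using s \<kappa>_nonneg by (intro nn_integral_cong) (simp add: \<rho>_def ennreal_mult')
        also have "\<dots> = ennreal (\<kappa> t s) * (\<integral>\<^sup>+\<omega>. ennreal (exp (p * (W t \<omega> - W s \<omega>))) * ennreal (\<bar>z s \<omega>\<bar> powr p) \<partial>M)"
          by (rule nn_integral_cmult) measurable
        also have "\<dots> \<le> ennreal (\<kappa> t s) * (ennreal C * ennreal (m s powr p))"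
          using True t by (intro mult_left_mono zm) auto
        also have "\<dots> = ennreal C * (ennreal (\<kappa> t s) * ennreal (m s powr p))" by (simp only: ac_simps)
        also have "ennreal (\<kappa> t s) * ennreal (m s powr p) = ennreal (exp (2 * B * p)) * ennreal (m s)"
          using True m_pos[of s] by (simp add: \<kappa>_def ennreal_mult'[symmetric] powr_diff)
        finally show ?thesis using s by (simp add: ac_simps)
      next
        case False
        then have "\<rho> t s \<omega> = 0" for \<omega> by (auto simp: \<rho>_def \<kappa>_def)
        then show ?thesis by simp
      qed
    qed
    also have "\<dots> = ennreal (exp (2 * B * p)) * ennreal C * ennreal K"
      by (subst nn_integral_cmult) (simp_all only: m_fin, measurable)
    finally show ?thesis by (simp add: mult_left_mono)
  qed
  have "J M T a W z F (\<lambda>_. 0) \<le> (\<integral>\<^sup>+\<omega>. (\<integral>\<^sup>+t. ennreal (indicator {0..T} t * L t)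
      * (2 + ennreal (\<bar>indicator {0..T} t * ?x t \<omega>\<bar> powr p)) \<partial>lborel) \<partial>M)"
    unfolding J_indicator_form
  proof (intro nn_integral_mono)
    fix t \<omega>
    show "ennreal (indicator {0..T} t * F t (?x t \<omega>)) \<le> ennreal (indicator {0..T} t * L t)
      * (2 + ennreal (\<bar>indicator {0..T} t * ?x t \<omega>\<bar> powr p))"
    proof (cases "t \<in> {0..T}")
      case True
      have "ennreal (F t (?x t \<omega>)) \<le> ennreal (L t * (2 + \<bar>?x t \<omega>\<bar> powr p))" by (intro ennreal_leI growth True)
      also have "\<dots> = ennreal (L t) * (2 + ennreal (\<bar>?x t \<omega>\<bar> powr p))"
        using L(2)[OF True] by (simp add: ennreal_mult')
      finally show ?thesis using True by simp
    qed simp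
  qed
  also have "\<dots> = (\<integral>\<^sup>+t. (\<integral>\<^sup>+\<omega>. ennreal (indicator {0..T} t * L t)
      * (2 + ennreal (\<bar>indicator {0..T} t * ?x t \<omega>\<bar> powr p)) \<partial>M) \<partial>lborel)"
    by (rule Fubini') measurable
  also have "\<dots> \<le> (\<integral>\<^sup>+t. ennreal (indicator {0..T} t * L t) * (2 + ?Q) \<partial>lborel)"
  proof (rule nn_integral_mono)
    fix t
    have "(\<integral>\<^sup>+\<omega>. ennreal (indicator {0..T} t * L t) * (2 + ennreal (\<bar>indicator {0..T} t * ?x t \<omega>\<bar> powr p)) \<partial>M)
      = ennreal (indicator {0..T} t * L t) * (2 + (\<integral>\<^sup>+\<omega>. ennreal (\<bar>indicator {0..T} t * ?x t \<omega>\<bar> powr p) \<partial>M))"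
      by (subst nn_integral_cmult, measurable, subst nn_integral_add) (auto simp: emeasure_space_1)
    also have "\<dots> \<le> ennreal (indicator {0..T} t * L t) * (2 + ?Q)"
    proof (cases "t \<in> {0..T}")
      case True
      then show ?thesis by (intro mult_left_mono add_left_mono moment) auto
    qed simp
    finally show "(\<integral>\<^sup>+\<omega>. ennreal (indicator {0..T} t * L t) * (2 + ennreal (\<bar>indicator {0..T} t * ?x t \<omega>\<bar> powr p)) \<partial>M)
      \<le> ennreal (indicator {0..T} t * L t) * (2 + ?Q)" .
  qed
  also have "\<dots> = (\<integral>\<^sup>+t. ennreal (indicator {0..T} t * L t) \<partial>lborel) * (2 + ?Q)"
    by (rule nn_integral_multc) measurable
  also have "(\<integral>\<^sup>+t. ennreal (indicator {0..T} t * L t) \<partial>lborel) = ennreal (\<integral>t. indicator {0..T} t * L t \<partial>lborel)"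
    using L by (intro nn_integral_eq_integral) (auto simp: L1_def set_integrable_def indicator_def)
  also have "\<dots> * (2 + ?Q) < \<infinity>" by (simp add: ennreal_mult_less_top)
  finally show ?thesis .
qed

end

section \<open>Boundedness and weak convergence of the penalized minimizers\<close>

theorem corollary5p13:
  fixes M :: "'a measure" and Fil :: "real \<Rightarrow> 'a measure"
    and W z :: "real \<Rightarrow> 'a \<Rightarrow> real"
    and a :: "real \<Rightarrow> real" and F F\<^sub>1 F\<^sub>2 :: "real \<Rightarrow> real \<Rightarrow> real"
    and \<Psi> :: "real \<Rightarrow> real"
    and ubar :: "real \<Rightarrow> real" and ubar_pen :: "real \<Rightarrow> real \<Rightarrow> real"
    and T p :: real
  assumes T: "0 < T"
    and W: "brownian_motion M Fil W"
    and a: "a \<in> Linf T"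
    and z_adapted: "\<And>t. t \<in> {0..T} \<Longrightarrow> z t \<in> borel_measurable (Fil t)"
    and z_measurable: "(\<lambda>(t, \<omega>). z t \<omega>) \<in> borel_measurable (restrict_space borel {0..T} \<Otimes>\<^sub>M M)"
    and p: "2 \<le> p"
    and z_Lp: "\<And>t. t \<in> {0..T} \<Longrightarrow> integrable M (\<lambda>\<omega>. \<bar>z t \<omega>\<bar> powr p)"
    and z_int: "(\<integral>\<^sup>+t\<in>{0..T}. ennreal ((\<integral>\<omega>. \<bar>z t \<omega>\<bar> powr p \<partial>M) powr (2 / p)) \<partial>lborel) < \<infinity>"
    and F_measurable: "(\<lambda>(t, x). F t x) \<in> borel_measurable (restrict_space borel ({0..T} \<times> UNIV))"
    and F_nonneg: "\<And>t x. t \<in> {0..T} \<Longrightarrow> 0 \<le> F t x"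
    and F_deriv1: "\<And>t x. t \<in> {0..T} \<Longrightarrow> (F t has_real_derivative F\<^sub>1 t x) (at x)"
    and F_deriv2: "\<And>t x. t \<in> {0..T} \<Longrightarrow> (F\<^sub>1 t has_real_derivative F\<^sub>2 t x) (at x)"
    and F_cont1: "continuous_on ({0..T} \<times> UNIV) (\<lambda>(t, x). F\<^sub>1 t x)"
    and F_cont2: "continuous_on ({0..T} \<times> UNIV) (\<lambda>(t, x). F\<^sub>2 t x)"
    and F_growth: "\<exists>\<alpha> L. 0 < \<alpha> \<and> \<alpha> < p \<and> L \<in> L1 T \<and> (\<forall>t\<in>{0..T}. 0 \<le> L t) \<and>
      (\<forall>t\<in>{0..T}. \<forall>x. \<bar>F t x\<bar> + \<bar>F\<^sub>1 t x\<bar> + \<bar>F\<^sub>2 t x\<bar> \<le> L t * (1 + \<bar>x\<bar> powr \<alpha>))"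
    and F_convex: "\<And>t. t \<in> {0..T} \<Longrightarrow> convex_on UNIV (F t)"
    and Psi: "young_function \<Psi>" "Delta2 \<Psi>"
    and ubar: "ubar \<in> LPsi T \<Psi>" "is_arg_min (J M T a W z F) (\<lambda>u. u \<in> L1 T) ubar"
    and ubar_pen: "\<And>\<delta>. 0 < \<delta> \<Longrightarrow>
      is_arg_min (J_pen M T a W z F \<Psi> \<delta>) (\<lambda>u. u \<in> L1 T) (ubar_pen \<delta>)"
  shows "(\<exists>C \<delta>\<^sub>0. 0 < C \<and> 0 < \<delta>\<^sub>0 \<and> (\<forall>\<delta>. 0 < \<delta> \<longrightarrow> \<delta> < \<delta>\<^sub>0 \<longrightarrow> FPsi T \<Psi> (ubar_pen \<delta>) \<le> ennreal C)) \<and>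
    ((\<forall>t\<in>{0..T}. strictly_convex (F t)) \<longrightarrow>
      (\<exists>\<delta> :: nat \<Rightarrow> real. (\<forall>n. 0 < \<delta> n) \<and> \<delta> \<longlonglongrightarrow> 0 \<and> weak_L1_limit T (\<lambda>n. ubar_pen (\<delta> n)) ubar))"
proof -
  interpret brownian_motion M Fil W by (rule W)
  \<comment> \<open>Replacing \<open>W\<close> by \<open>0\<close> on a null set that contains all discontinuous paths gives a jointly measurable
    process with the same cost.\<close>
  obtain N where N: "N \<in> null_sets M" "{\<omega> \<in> space M. \<not> continuous_on {0..} (\<lambda>t. W t \<omega>)} \<subseteq> N"
    using continuous_paths by (auto elim!: AE_E simp: null_sets_def)
  define V where "V t \<omega> = (if \<omega> \<in> N then 0 else W (max 0 t) \<omega>)" for t \<omega>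
  have V_eq: "V t \<omega> = W t \<omega>" if "\<omega> \<notin> N" "0 \<le> t" for t \<omega> using that by (simp add: V_def)
  have notN: "AE \<omega> in M. \<omega> \<notin> N" using N(1) by (rule AE_not_in)
  have V_cont: "continuous_on UNIV (\<lambda>t. V t \<omega>)" if "\<omega> \<in> space M" for \<omega>
  proof (cases "\<omega> \<in> N")
    case False
    then have "continuous_on {0..} (\<lambda>t. W t \<omega>)" using N(2) that by blast
    then have "continuous_on UNIV (\<lambda>t. W (max 0 t) \<omega>)"
      by (rule continuous_on_compose2[where f="\<lambda>t. max 0 t"]) (auto intro!: continuous_intros)
    then show ?thesis using False by (simp add: V_def)
  qed (simp add: V_def)
  have V_meas: "(\<lambda>(t, \<omega>). V t \<omega>) \<in> borel_measurable (borel \<Otimes>\<^sub>M M)"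
  proof (rule borel_measurable_continuous_process[OF _ V_cont])
    fix t
    have [measurable]: "W (max 0 t) \<in> borel_measurable M"
      by (rule measurable_from_subalg[OF subalg adapted]) auto
    have [measurable]: "N \<in> sets M" using N(1) by auto
    show "V t \<in> borel_measurable M" unfolding V_def[abs_def] by measurable
  qed
  \<comment> \<open>Precomposing with the projection of the line onto \<open>{0..T}\<close> extends functions measurable on the
    restricted space to the whole line.\<close>
  define cl where "cl t = max 0 (min T t)" for t
  have cl: "cl t \<in> {0..T}" "t \<in> {0..T} \<Longrightarrow> cl t = t" for t using T by (auto simp: cl_def)
  have cl_meas[measurable]: "cl \<in> borel_measurable borel" unfolding cl_def[abs_def] by measurable
  have z_meas: "(\<lambda>(t, \<omega>). indicator {0..T} t * z t \<omega>) \<in> borel_measurable (borel \<Otimes>\<^sub>M M)"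
  proof -
    have "(\<lambda>(t, \<omega>). (cl t, \<omega>)) \<in> borel \<Otimes>\<^sub>M M \<rightarrow>\<^sub>M restrict_space borel {0..T} \<Otimes>\<^sub>M M"
      unfolding case_prod_beta
      by (intro measurable_Pair measurable_restrict_space2 measurable_compose[OF measurable_fst cl_meas] measurable_snd)
        (use cl in auto)
    from measurable_compose[OF this z_measurable]
    have [measurable]: "(\<lambda>(t, \<omega>). z (cl t) \<omega>) \<in> borel_measurable (borel \<Otimes>\<^sub>M M)"
      by (simp add: case_prod_beta)
    have eq: "indicator {0..T} t * z t \<omega> = indicator {0..T} t * z (cl t) \<omega>" for t \<omega>
      using cl(2)[of t] by (auto simp: indicator_def)
    show ?thesis unfolding eq by measurable
  qed
  have F_meas: "(\<lambda>(t, x). indicator {0..T} t * F t x) \<in> borel_measurable (borel \<Otimes>\<^sub>M borel)"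
  proof -
    have "(\<lambda>(t, x). (cl t, x)) \<in> borel \<Otimes>\<^sub>M borel \<rightarrow>\<^sub>M restrict_space (borel :: (real \<times> real) measure) ({0..T} \<times> UNIV)"
      unfolding case_prod_beta
      by (intro measurable_restrict_space2 borel_measurable_Pair measurable_compose[OF measurable_fst cl_meas] measurable_snd)
        (use cl in auto)
    from measurable_compose[OF this F_measurable]
    have [measurable]: "(\<lambda>(t, x). F (cl t) x) \<in> borel_measurable (borel \<Otimes>\<^sub>M borel)"
      by (simp add: case_prod_beta)
    have eq: "indicator {0..T} t * F t x = indicator {0..T} t * F (cl t) x" for t x
      using cl(2)[of t] by (auto simp: indicator_def)
    show ?thesis unfolding eq by measurable
  qed
  interpret R: regular_cost M T a V z F
  proof (unfold_locales)
    show "set_integrable lborel {0..T} a"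
    proof -
      obtain K where "AE t in lborel. t \<in> {0..T} \<longrightarrow> \<bar>a t\<bar> \<le> K" using a by (auto simp: Linf_def)
      then have bd: "AE t in lborel. norm (indicator {0..T} t *\<^sub>R a t) \<le> norm (K * indicator {0..T} t)"
        by eventually_elim (auto simp: indicator_def)
      have const: "integrable lborel (\<lambda>t. K * indicator {0..T} t)"
        by (intro integrable_mult_right integrable_real_indicator) (auto simp: emeasure_lborel_Icc_eq)
      have "(\<lambda>t. indicator {0..T} t *\<^sub>R a t) \<in> borel_measurable lborel"
        using a by (auto simp: Linf_def set_borel_measurable_def)
      then show ?thesis
        unfolding set_integrable_def by (rule Bochner_Integration.integrable_bound[OF const _ bd])
    qed
    show "continuous_on {0..T} (\<lambda>t. V t \<omega>)" if "\<omega> \<in> space M" for \<omega>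
      by (rule continuous_on_subset[OF V_cont[OF that]]) simp
  qed (fact T V_meas z_meas F_meas F_nonneg)+
  have J_eq: "J M T a W z F u = J M T a V z F u" for u
    unfolding J_def
  proof (rule nn_integral_cong_AE)
    show "AE \<omega> in M. (\<integral>\<^sup>+t\<in>{0..T}. ennreal (F t (\<xi> a W z u t \<omega>)) \<partial>lborel)
        = (\<integral>\<^sup>+t\<in>{0..T}. ennreal (F t (\<xi> a V z u t \<omega>)) \<partial>lborel)"
      using notN
    proof eventually_elim
      case (elim \<omega>)
      have "\<xi> a W z u t \<omega> = \<xi> a V z u t \<omega>" if "t \<in> {0..T}" for t
        using that V_eq[OF elim] unfolding \<xi>_def G_def set_lebesgue_integral_def
        by (auto intro!: arg_cong2[where f="(*)"] Bochner_Integration.integral_cong simp: indicator_def)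
      then show ?case by (intro nn_integral_cong) (auto simp: indicator_def)
    qed
  qed
  \<comment> \<open>The summand \<open>1\<close> keeps the weight positive where \<open>z s\<close> vanishes; integrability follows from
    \<open>1 + x \<le> 2 + x\<^sup>2\<close> and the hypothesis on the squared norms.\<close>
  define m where "m s = 1 + (\<integral>\<omega>. \<bar>indicator {0..T} s * z s \<omega>\<bar> powr p \<partial>M) powr (1 / p)" for s
  have m_pos: "0 < m s" for s by (simp add: m_def add_pos_nonneg)
  have m_meas[measurable]: "m \<in> borel_measurable borel"
  proof -
    note [measurable] = z_meas
    show ?thesis unfolding m_def[abs_def] by measurable
  qed
  have moment: "(\<integral>\<^sup>+\<omega>. ennreal (\<bar>z s \<omega>\<bar> powr p) \<partial>M) \<le> ennreal (m s powr p)" if s: "s \<in> {0..T}" for s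
  proof -
    have I: "0 \<le> (\<integral>\<omega>. \<bar>z s \<omega>\<bar> powr p \<partial>M)" by (intro integral_nonneg_AE) auto
    have "(\<integral>\<omega>. \<bar>z s \<omega>\<bar> powr p \<partial>M) = ((\<integral>\<omega>. \<bar>z s \<omega>\<bar> powr p \<partial>M) powr (1 / p)) powr p"
      using I p by (simp add: powr_powr)
    also have "\<dots> \<le> m s powr p" using s p by (intro powr_mono2) (auto simp: m_def)
    finally show ?thesis using nn_integral_eq_integral[OF z_Lp[OF s]] by (simp add: ennreal_leI)
  qed
  have m_int: "set_integrable lborel {0..T} m"
    unfolding set_integrable_def
  proof (rule integrableI_bounded)
    let ?I = "\<lambda>s. (\<integral>\<omega>. \<bar>indicator {0..T} s * z s \<omega>\<bar> powr p \<partial>M)"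
    note [measurable] = z_meas
    have "(\<integral>\<^sup>+s. ennreal (norm (indicator {0..T} s *\<^sub>R m s)) \<partial>lborel)
        \<le> (\<integral>\<^sup>+s. ennreal 2 * indicator {0..T} s + ennreal (?I s powr (2 / p)) * indicator {0..T} s \<partial>lborel)"
    proof (rule nn_integral_mono)
      fix s
      have sq: "(?I s powr (1 / p)) ^ 2 = ?I s powr (2 / p)"
        by (simp add: powr_powr flip: powr_numeral powr_realpow)
      have "m s \<le> 2 + (?I s powr (1 / p)) ^ 2"
      proof -
        have "0 \<le> (?I s powr (1 / p) - 1) ^ 2" by simp
        then have "2 * ?I s powr (1 / p) \<le> 1 + (?I s powr (1 / p)) ^ 2" by (simp add: power2_diff)
        moreover have "0 \<le> ?I s powr (1 / p)" by simp
        ultimately show ?thesis unfolding m_def by linarith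
      qed
      then have "ennreal (m s) \<le> ennreal (2 + ?I s powr (2 / p))" unfolding sq by (rule ennreal_leI)
      also have "\<dots> = ennreal 2 + ennreal (?I s powr (2 / p))" by (rule ennreal_plus) auto
      finally show "ennreal (norm (indicator {0..T} s *\<^sub>R m s))
          \<le> ennreal 2 * indicator {0..T} s + ennreal (?I s powr (2 / p)) * indicator {0..T} s"
        using m_pos[of s] by (auto simp: indicator_def)
    qed
    also have "\<dots> = (\<integral>\<^sup>+s. ennreal 2 * indicator {0..T} s \<partial>lborel) + (\<integral>\<^sup>+s. ennreal (?I s powr (2 / p)) * indicator {0..T} s \<partial>lborel)"
      by (rule nn_integral_add) measurable
    also have "(\<integral>\<^sup>+s. ennreal (?I s powr (2 / p)) * indicator {0..T} s \<partial>lborel)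
        = (\<integral>\<^sup>+t\<in>{0..T}. ennreal ((\<integral>\<omega>. \<bar>z t \<omega>\<bar> powr p \<partial>M) powr (2 / p)) \<partial>lborel)"
      by (intro nn_integral_cong) (auto simp: indicator_def)
    also have "(\<integral>\<^sup>+s. ennreal 2 * indicator {0..T} s \<partial>lborel) + \<dots> < \<infinity>"
      using z_int T by (auto simp: nn_integral_cmult_indicator emeasure_lborel_Icc_eq ennreal_mult_less_top)
    finally show "(\<integral>\<^sup>+s. ennreal (norm (indicator {0..T} s *\<^sub>R m s)) \<partial>lborel) < \<infinity>" .
  qed measurable
  have exp_moment: "(\<integral>\<^sup>+\<omega>. ennreal (exp (p * (V t \<omega> - V s \<omega>))) * ennreal (\<bar>z s \<omega>\<bar> powr p) \<partial>M)
      \<le> ennreal (exp (p\<^sup>2 * T / 2)) * ennreal (m s powr p)" if st: "0 \<le> s" "s \<le> t" "t \<le> T" for s t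
  proof -
    have s: "s \<in> {0..T}" using st by simp
    note [measurable] = z_adapted[OF s]
    have "(\<integral>\<^sup>+\<omega>. ennreal (exp (p * (V t \<omega> - V s \<omega>))) * ennreal (\<bar>z s \<omega>\<bar> powr p) \<partial>M)
        = (\<integral>\<^sup>+\<omega>. ennreal (exp (p * (W t \<omega> - W s \<omega>))) * ennreal (\<bar>z s \<omega>\<bar> powr p) \<partial>M)"
      using notN st by (intro nn_integral_cong_AE) (auto elim!: eventually_mono simp: V_eq)
    also have "\<dots> = ennreal (exp (p\<^sup>2 * (t - s) / 2)) * (\<integral>\<^sup>+\<omega>. ennreal (\<bar>z s \<omega>\<bar> powr p) \<partial>M)"
      by (rule nn_integral_exp_increment_mult) (use st in auto)
    also have "\<dots> \<le> ennreal (exp (p\<^sup>2 * T / 2)) * ennreal (m s powr p)"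
      using st by (intro mult_mono moment s ennreal_leI) (auto intro!: mult_left_mono divide_right_mono)
    finally show ?thesis .
  qed
  obtain \<alpha> L where L: "0 < \<alpha>" "\<alpha> < p" "L \<in> L1 T" "\<And>t. t \<in> {0..T} \<Longrightarrow> 0 \<le> L t"
    and growth: "\<And>t x. t \<in> {0..T} \<Longrightarrow> \<bar>F t x\<bar> + \<bar>F\<^sub>1 t x\<bar> + \<bar>F\<^sub>2 t x\<bar> \<le> L t * (1 + \<bar>x\<bar> powr \<alpha>)"
    using F_growth by blast
  have growth_p: "F t x \<le> L t * (2 + \<bar>x\<bar> powr p)" if t: "t \<in> {0..T}" for t x
  proof -
    have "\<bar>x\<bar> powr \<alpha> \<le> 1 + \<bar>x\<bar> powr p"
    proof (cases "\<bar>x\<bar> \<le> 1")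
      case True
      then have "\<bar>x\<bar> powr \<alpha> \<le> 1" using L(1) by (intro powr_le1) auto
      then show ?thesis by (simp add: add_increasing2)
    next
      case False
      then have "\<bar>x\<bar> powr \<alpha> \<le> \<bar>x\<bar> powr p" using L(2) by (intro powr_mono) auto
      then show ?thesis by simp
    qed
    then have "L t * (1 + \<bar>x\<bar> powr \<alpha>) \<le> L t * (2 + \<bar>x\<bar> powr p)" using L(4)[OF t] by (intro mult_left_mono) auto
    then show ?thesis using growth[OF t, of x] by linarith
  qed
  have p1: "1 \<le> p" using p by simp
  have z_path: "AE \<omega> in M. set_integrable lborel {0..T} (\<lambda>s. z s \<omega>)"
    by (rule R.AE_z_path_integrable[OF p1 m_meas m_pos m_int moment])
  have ubar_L1: "ubar \<in> L1 T" and J_min: "\<And>u. u \<in> L1 T \<Longrightarrow> J M T a W z F ubar \<le> J M T a W z F u"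
    using ubar(2) by (auto simp: is_arg_min_def not_less)
  have "J M T a W z F ubar \<le> J M T a W z F (\<lambda>_. 0)" by (rule J_min) (simp add: L1_def set_integrable_def)
  also have "\<dots> < \<infinity>" unfolding J_eq
    by (rule R.J_zero_finite[OF p1 m_meas m_pos m_int exp_moment L(3,4) growth_p])
  finally have J_fin: "J M T a W z F ubar < \<infinity>" .
  have Psi_fin: "FPsi T \<Psi> ubar < \<infinity>" by (rule Delta2_FPsi_finite[OF Psi ubar(1)])
  have pen_L1: "ubar_pen \<delta> \<in> L1 T"
    and pen_min: "J M T a W z F (ubar_pen \<delta>) + ennreal \<delta> * FPsi T \<Psi> (ubar_pen \<delta>)
      \<le> J M T a W z F ubar + ennreal \<delta> * FPsi T \<Psi> ubar" if "0 < \<delta>" for \<delta>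
    using ubar_pen[OF that] ubar_L1 by (auto simp: is_arg_min_def not_less J_pen_def)
  have Psi_le: "FPsi T \<Psi> (ubar_pen \<delta>) \<le> FPsi T \<Psi> ubar" if \<delta>: "0 < \<delta>" for \<delta>
  proof -
    have "J M T a W z F ubar + ennreal \<delta> * FPsi T \<Psi> (ubar_pen \<delta>)
        \<le> J M T a W z F (ubar_pen \<delta>) + ennreal \<delta> * FPsi T \<Psi> (ubar_pen \<delta>)"
      by (intro add_right_mono J_min pen_L1 \<delta>)
    also note pen_min[OF \<delta>]
    finally have "ennreal \<delta> * FPsi T \<Psi> (ubar_pen \<delta>) \<le> ennreal \<delta> * FPsi T \<Psi> ubar"
      using J_fin by (auto simp: ennreal_add_left_cancel_le)
    then show ?thesis using \<delta> by (simp add: ennreal_mult_le_mult_iff)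
  qed
  define C where "C = enn2real (FPsi T \<Psi> ubar)"
  have C: "FPsi T \<Psi> ubar = ennreal C" "0 \<le> C" using Psi_fin by (auto simp: C_def)
  have bounded: "\<exists>C \<delta>\<^sub>0. 0 < C \<and> 0 < \<delta>\<^sub>0 \<and> (\<forall>\<delta>. 0 < \<delta> \<longrightarrow> \<delta> < \<delta>\<^sub>0 \<longrightarrow> FPsi T \<Psi> (ubar_pen \<delta>) \<le> ennreal C)"
  proof (intro exI[of _ "C + 1"] exI[of _ 1] conjI allI impI)
    fix \<delta> :: real assume "0 < \<delta>"
    have "FPsi T \<Psi> (ubar_pen \<delta>) \<le> ennreal C" using Psi_le[OF \<open>0 < \<delta>\<close>] by (simp only: C)
    also have "\<dots> \<le> ennreal (C + 1)" by (rule ennreal_leI) simp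
    finally show "FPsi T \<Psi> (ubar_pen \<delta>) \<le> ennreal (C + 1)" .
  qed (use C in auto)
  have weak: "\<exists>\<delta> :: nat \<Rightarrow> real. (\<forall>n. 0 < \<delta> n) \<and> \<delta> \<longlonglongrightarrow> 0 \<and> weak_L1_limit T (\<lambda>n. ubar_pen (\<delta> n)) ubar"
    if strict: "\<forall>t\<in>{0..T}. strictly_convex (F t)"
  proof -
    \<comment> \<open>A summable choice of penalties makes the excess costs summable.\<close>
    define \<delta> :: "nat \<Rightarrow> real" where "\<delta> n = (1 / 2) ^ n" for n
    have \<delta>: "0 < \<delta> n" for n by (simp add: \<delta>_def)
    have lim: "\<delta> \<longlonglongrightarrow> 0" unfolding \<delta>_def[abs_def] by (rule LIMSEQ_power_zero) simp
    have sum: "(\<Sum>n. ennreal (\<delta> n) * ennreal C) < \<infinity>"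
    proof -
      have "(\<Sum>n. ennreal (\<delta> n)) = ennreal (\<Sum>n. \<delta> n)"
        by (rule suminf_ennreal2) (auto simp: \<delta>_def intro!: summable_geometric)
      then show ?thesis by (simp add: ennreal_mult_less_top)
    qed
    have excess: "J M T a V z F (ubar_pen (\<delta> n)) \<le> J M T a V z F ubar + ennreal (\<delta> n) * ennreal C" for n
    proof -
      have "J M T a W z F (ubar_pen (\<delta> n)) \<le> J M T a W z F (ubar_pen (\<delta> n)) + ennreal (\<delta> n) * FPsi T \<Psi> (ubar_pen (\<delta> n))"
        by simp
      also note pen_min[OF \<delta>[of n]]
      finally show ?thesis by (simp only: J_eq C)
    qed
    have "AE \<omega> in M. AE t in lborel. t \<in> {0..T} \<longrightarrow>
        (\<lambda>n. \<xi> a V z (ubar_pen (\<delta> n)) t \<omega>) \<longlonglongrightarrow> \<xi> a V z ubar t \<omega>"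
      by (rule R.minimizing_sequence_state_converges[OF F_convex _ z_path pen_L1[OF \<delta>] ubar_L1 _ _ excess sum])
        (use strict J_min J_fin in \<open>auto simp: J_eq\<close>)
    then have "AE \<omega> in M. \<omega> \<in> space M \<and> set_integrable lborel {0..T} (\<lambda>s. z s \<omega>) \<and>
        (AE t in lborel. t \<in> {0..T} \<longrightarrow> (\<lambda>n. \<xi> a V z (ubar_pen (\<delta> n)) t \<omega>) \<longlonglongrightarrow> \<xi> a V z ubar t \<omega>)"
      using z_path AE_space by eventually_elim auto
    then obtain \<omega> where "\<omega> \<in> space M" "set_integrable lborel {0..T} (\<lambda>s. z s \<omega>)"
      "AE t in lborel. t \<in> {0..T} \<longrightarrow> (\<lambda>n. \<xi> a V z (ubar_pen (\<delta> n)) t \<omega>) \<longlonglongrightarrow> \<xi> a V z ubar t \<omega>"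
      using eventually_happens'[OF ae_filter_bot] by blast
    then have "weak_L1_limit T (\<lambda>n. ubar_pen (\<delta> n)) ubar"
      using Psi_le[OF \<delta>] by (intro R.state_converges_imp_weak_limit[OF Psi(1), where C=C] pen_L1 \<delta> ubar_L1) (simp_all only: C)
    with \<delta> lim show ?thesis by blast
  qed
  show ?thesis using bounded weak by blast
qed

end
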